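(* Let $1\le I<N$, $x\in[0,1)$, and suppose $I\le N-\sqrt{N+\frac54}+\frac12$. Suppose that no $k\le I$ is strategically positive, i.e. $\dot\Delta_J(k)\cdot\dot R_J(x)<0$ for all $1\le k\le I$. Then the probability of winning the one-step reselect game of best choice with parameters $N,I,x$ using the optimal strategy (i.e. the maximum winning probability over all strategies) is $$\sum_{\text{positive }(k,j)}\frac{\mu(k,j)}{N!}\left(\dot\Delta_J(k,j)\cdot\dot R_J(x)\right)=\sum_{\substack{1\le k\le N\\ 1\le j\le I+1}}\frac{\mu(k,j)}{N!}\max\left(0,\ \dot\Delta_J(k,j)\cdot\dot R_J(x)\right),$$ where the first sum is over pairs $(k,j)$ with $1\le k\le N$, $1\le j\le I+1$ and $\dot\Delta_J(k,j)\cdot\dot R_J(x)\ge0$.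
   Context: Permutations are written as words; $\pi_i$ is the value in position $i$. A bottom-to-top maximum of a permutation is an entry whose position is to the right of the positions of all entries with smaller value. For $\pi\in\mathfrak{S}_N$, the $J$-statistic $J(\pi)$ is the value of the next (leftmost) bottom-to-top maximum in a position greater than $I$; it lies in $\{1,\dots,I+1\}$. The $i$th prefix flattening of $\pi$ is the permutation in $\mathfrak{S}_i$ with the same relative order as $\pi_1,\dots,\pi_i$. The game: $\pi\in\mathfrak{S}_N$ is chosen at random with probability $R_{J(\pi)}(x)$, where $R_J(x)=\frac{1}{N!(1-x)^{N-I}}\sum_{h=0}^{J-1}\binom Nh x^h(1-x)^{N-h}$. The prefix flattenings of $\pi$ of sizes $1,2,\dots,N$ are presented sequentially. After each one the player either accepts the current candidate (and stops) or rejects it (and continues); if no earlier candidate is accepted, the last one must be accepted. The player wins iff they stop at the position containing value $N$. $\mu(k,j)=\frac{(k-I-1)\,I!\,(k-j-1)!}{(I-j+1)!}$ if $k>I+1$; $\mu(k,j)=0$ if $k=I+1$ and $j\le I$; and $\mu(k,j)=(k-1)!$ otherwise. (This is the number of permutations of size $k$ whose last entry is $k$ and, when $k>I$, whose $J$-statistic is $j$.) $\dot R_J(x)=x^{J-1}(1-x)^{I-(J-1)}$ for $1\le J\le I+1$ (with $0^0=1$), and $f_J\cdot\dot R_J(x)$ denotes $\sum_{J=1}^{I+1}f_J\dot R_J(x)$. For $k>I$: $\dot\Delta_J(k,j)=\dot\sigma_J(k)-\dot\tau^\circ_J(k)$ if $J\le j$ and $0$ if $J>j$, where $\dot\sigma_J(k)=\binom{N}{J-1}\frac{(N-J)!}{(k-J)!}$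 and $\dot\tau^\circ_J(k)=\dot\sigma_J(k)\sum_{i=k-J+1}^{N-J}\frac1i$. For $k\le I$: $\dot\Delta_J(k,j)=\dot\Delta_J(k)=\dot\sigma_J(k)-\dot\tau^\circ_J(k)$ for all $1\le J\le I+1$ (no dependence on $j$), where $\dot\sigma_J(k)=\frac{1}{(k-1)!}\binom{N}{J-1}\frac{(N-J)!(I-1)!}{(I-J)!}$ if $J\le I$ and $\dot\sigma_{I+1}(k)=0$; $\dot\tau^\circ_J(I)=\binom{N}{J-1}\frac{(N-J)!}{(I-J)!}\sum_{i=I-J+1}^{N-J}\frac1i$ if $J\le I$ and $\dot\tau^\circ_{I+1}(I)=\frac{N!}{I!(N-I)}$; and $\dot\tau^\circ_J(k)=\frac{(I-1)!}{(k-1)!}\dot\tau^\circ_J(I)+\dot\sigma_J(k)\sum_{i=k}^{I-1}\frac1i$ for $k<I$. Empty sums are $0$. *)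

theory Defs
  imports "HOL-Probability.Probability" "HOL-Combinatorics.Combinatorics"
begin

text \<open>
  A permutation of size \<open>n\<close> is a function \<open>p\<close> with \<open>p permutes {1..n}\<close>; \<open>p i\<close> is the value in
  position \<open>i\<close>.
\<close>

definition btt_max :: "nat \<Rightarrow> (nat \<Rightarrow> nat) \<Rightarrow> nat \<Rightarrow> bool" where
  "btt_max n p i \<longleftrightarrow> i \<in> {1..n} \<and> (\<forall>l\<in>{1..n}. p l < p i \<longrightarrow> l < i)"

definition J_stat :: "nat \<Rightarrow> nat \<Rightarrow> (nat \<Rightarrow> nat) \<Rightarrow> nat" where
  "J_stat n I p = p (LEAST i. i > I \<and> btt_max n p i)"

text \<open>
  The values are the ranks of \<open>p 1, \<dots>, p k\<close>; off \<open>{1..k}\<close> it is the identity, so that the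
  result permutes \<open>{1..k}\<close>.
\<close>

definition prefix_flattening :: "nat \<Rightarrow> (nat \<Rightarrow> nat) \<Rightarrow> (nat \<Rightarrow> nat)" where
  "prefix_flattening k p = (\<lambda>i. if i \<in> {1..k} then card {l \<in> {1..k}. p l \<le> p i} else i)"

definition R_prob :: "nat \<Rightarrow> nat \<Rightarrow> real \<Rightarrow> nat \<Rightarrow> real" where
  "R_prob N I x J =
     1 / (fact N * (1 - x) ^ (N - I)) *
     (\<Sum>h = 0..<J. real (N choose h) * x ^ h * (1 - x) ^ (N - h))"

definition game_pmf :: "nat \<Rightarrow> nat \<Rightarrow> real \<Rightarrow> (nat \<Rightarrow> nat) pmf" where
  "game_pmf N I x =
     embed_pmf (\<lambda>p. if p permutes {1..N} then R_prob N I x (J_stat N I p) else 0)"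

text \<open>
  A strategy decides, for each size \<open>k\<close> and each permutation of size \<open>k\<close>, whether to accept when
  the \<open>k\<close>th prefix flattening is that permutation.  The \<open>k\<close>th prefix flattening determines all
  earlier ones, so this is the whole information available to the player.  The size is a separate
  argument because a function on \<^typ>\<open>nat\<close> does not determine it.
\<close>

type_synonym strategy = "nat \<Rightarrow> (nat \<Rightarrow> nat) \<Rightarrow> bool"

definition stop_position :: "nat \<Rightarrow> strategy \<Rightarrow> (nat \<Rightarrow> nat) \<Rightarrow> nat" where
  "stop_position N A p = (LEAST k. 1 \<le> k \<and> (A k (prefix_flattening k p) \<or> k = N))"

definition wins :: "nat \<Rightarrow> strategy \<Rightarrow> (nat \<Rightarrow> nat) \<Rightarrow> bool" where
  "wins N A p \<longleftrightarrow> p (stop_position N A p) = N"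

definition win_prob :: "nat \<Rightarrow> nat \<Rightarrow> real \<Rightarrow> strategy \<Rightarrow> real" where
  "win_prob N I x A = measure_pmf.prob (game_pmf N I x) {p. wins N A p}"

definition optimal_win_prob :: "nat \<Rightarrow> nat \<Rightarrow> real \<Rightarrow> real" where
  "optimal_win_prob N I x = Max (range (win_prob N I x))"

definition mu :: "nat \<Rightarrow> nat \<Rightarrow> nat \<Rightarrow> real" where
  "mu I k j =
     (if k > I + 1 then real (k - I - 1) * fact I * fact (k - j - 1) / fact (I + 1 - j)
      else if k = I + 1 \<and> j \<le> I then 0
      else fact (k - 1))"

definition R_dot :: "nat \<Rightarrow> real \<Rightarrow> nat \<Rightarrow> real" where
  "R_dot I x J = x ^ (J - 1) * (1 - x) ^ (I - (J - 1))"

definition dot_R :: "nat \<Rightarrow> real \<Rightarrow> (nat \<Rightarrow> real) \<Rightarrow> real" where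
  "dot_R I x f = (\<Sum>J = 1..I + 1. f J * R_dot I x J)"

definition sigma_dot :: "nat \<Rightarrow> nat \<Rightarrow> nat \<Rightarrow> nat \<Rightarrow> real" where
  "sigma_dot N I k J =
     (if k > I then real (N choose (J - 1)) * fact (N - J) / fact (k - J)
      else if J \<le> I then
        1 / fact (k - 1) * (real (N choose (J - 1)) * fact (N - J) * fact (I - 1) / fact (I - J))
      else 0)"

text \<open>\<open>tau_dot_I\<close> is \<open>tau_dot\<close> at \<open>k = I\<close>.\<close>

definition tau_dot_I :: "nat \<Rightarrow> nat \<Rightarrow> nat \<Rightarrow> real" where
  "tau_dot_I N I J =
     (if J \<le> I then
        real (N choose (J - 1)) * fact (N - J) / fact (I - J) *
        (\<Sum>i = I - J + 1..N - J. 1 / real i)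
      else fact N / (fact I * real (N - I)))"

definition tau_dot :: "nat \<Rightarrow> nat \<Rightarrow> nat \<Rightarrow> nat \<Rightarrow> real" where
  "tau_dot N I k J =
     (if k > I then sigma_dot N I k J * (\<Sum>i = k - J + 1..N - J. 1 / real i)
      else if k = I then tau_dot_I N I J
      else fact (I - 1) / fact (k - 1) * tau_dot_I N I J +
           sigma_dot N I k J * (\<Sum>i = k..I - 1. 1 / real i))"

definition Delta_dot :: "nat \<Rightarrow> nat \<Rightarrow> nat \<Rightarrow> nat \<Rightarrow> nat \<Rightarrow> real" where
  "Delta_dot N I k j J =
     (if k \<le> I \<or> J \<le> j then sigma_dot N I k J - tau_dot N I k J else 0)"

text \<open>For \<open>k \<le> I\<close> the value of \<^const>\<open>Delta_dot\<close> does not depend on \<open>j\<close>.\<close>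

definition Delta_dot_low :: "nat \<Rightarrow> nat \<Rightarrow> nat \<Rightarrow> nat \<Rightarrow> real" where
  "Delta_dot_low N I k J = sigma_dot N I k J - tau_dot N I k J"

lemma Delta_dot_eq_low: "k \<le> I \<Longrightarrow> Delta_dot N I k j = Delta_dot_low N I k"
  by (simp add: fun_eq_iff Delta_dot_def Delta_dot_low_def)


subsection \<open>The prescribed masses form a probability distribution\<close>

lemma J_stat_eq_Min:
  assumes p: "p permutes {1..N}" and IN: "I < N"
  shows "J_stat N I p = Min (p ` {I+1..N})"
proof -
  have "Min (p ` {I+1..N}) \<in> p ` {I+1..N}"
    using IN by (intro Min_in) auto
  then obtain m where m: "m \<in> {I+1..N}" "Min (p ` {I+1..N}) = p m" by auto
  have le: "p m \<le> p l" if "l \<in> {I+1..N}" for l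
    using that m(2) by (metis Min_le finite_atLeastAtMost finite_imageI imageI)
  have inj: "inj p" using p by (rule permutes_inj)
  have 1: "m > I \<and> btt_max N p m"
    unfolding btt_max_def
  proof (intro conjI ballI impI)
    fix l assume l: "l \<in> {1..N}" "p l < p m"
    show "l < m"
    proof (rule ccontr)
      assume "\<not> l < m"
      then show False using le[of l] l m(1) by simp
    qed
  qed (use m(1) in auto)
  have 2: "m \<le> i" if "i > I \<and> btt_max N p i" for i
  proof (rule ccontr)
    assume "\<not> m \<le> i"
    then have "i < m" by simp
    have i: "i \<in> {I+1..N}" and btt: "\<And>l. l \<in> {1..N} \<Longrightarrow> p l < p i \<Longrightarrow> l < i"
      using that by (auto simp: btt_max_def)
    have "p m \<noteq> p i" using \<open>i < m\<close> injD[OF inj, of m i] by auto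
    with le[OF i] have "p m < p i" by simp
    moreover have "m \<in> {1..N}" using m(1) by simp
    ultimately show False using btt[of m] \<open>i < m\<close> by simp
  qed
  have "(LEAST i. i > I \<and> btt_max N p i) = m"
    using 1 2 by (rule Least_equality)
  then show ?thesis unfolding J_stat_def m(2) by simp
qed

lemma less_J_stat_iff:
  assumes p: "p permutes {1..N}" and IN: "I < N"
  shows "h < J_stat N I p \<longleftrightarrow> {i\<in>{1..N}. p i \<le> h} \<subseteq> {1..I}"
proof -
  have "h < J_stat N I p \<longleftrightarrow> (\<forall>i\<in>{I+1..N}. h < p i)"
    unfolding J_stat_eq_Min[OF assms] using IN by (subst Min_gr_iff) auto
  also have "\<dots> \<longleftrightarrow> {i\<in>{1..N}. p i \<le> h} \<subseteq> {1..I}"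
  proof
    assume *: "\<forall>i\<in>{I+1..N}. h < p i"
    show "{i\<in>{1..N}. p i \<le> h} \<subseteq> {1..I}"
    proof
      fix i assume i: "i \<in> {i\<in>{1..N}. p i \<le> h}"
      then have "p i \<le> h" by simp
      then have "i \<notin> {I+1..N}" using bspec[OF *, of i] by linarith
      then show "i \<in> {1..I}" using i by auto
    qed
  next
    assume *: "{i\<in>{1..N}. p i \<le> h} \<subseteq> {1..I}"
    show "\<forall>i\<in>{I+1..N}. h < p i"
    proof
      fix i assume i: "i \<in> {I+1..N}"
      then have "i \<notin> {i\<in>{1..N}. p i \<le> h}" using subsetD[OF *, of i] by auto
      then show "h < p i" using i by auto
    qed
  qed
  finally show ?thesis .
qed

lemma card_low_positions:
  assumes p: "p permutes {1..N}" and h: "h \<le> N"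
  shows "card {i\<in>{1..N}. p i \<le> h} = h"
proof -
  have "p ` {i\<in>{1..N}. p i \<le> h} = {1..h}"
  proof
    show "p ` {i\<in>{1..N}. p i \<le> h} \<subseteq> {1..h}"
      using permutes_in_image[OF p] by force
    show "{1..h} \<subseteq> p ` {i\<in>{1..N}. p i \<le> h}"
    proof
      fix v assume v: "v \<in> {1..h}"
      then have "v \<in> p ` {1..N}" using h permutes_image[OF p] by auto
      then show "v \<in> p ` {i\<in>{1..N}. p i \<le> h}" using v by auto
    qed
  qed
  moreover have "inj_on p {i\<in>{1..N}. p i \<le> h}"
    using permutes_inj[OF p] by (rule inj_on_subset) auto
  ultimately show ?thesis by (metis card_image card_atLeastAtMost diff_Suc_1)
qed

lemma ex_permutes_image:
  assumes "finite A" "S \<subseteq> A" "T \<subseteq> A" "card S = card T"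
  shows "\<exists>t. t permutes A \<and> t ` S = T"
proof -
  have fin: "finite S" "finite T" using assms finite_subset by auto
  obtain f where f: "bij_betw f S T"
    using finite_same_card_bij[OF fin assms(4)] by auto
  have "card (A - S) = card (A - T)"
    using assms fin by (simp add: card_Diff_subset)
  then obtain g where g: "bij_betw g (A - S) (A - T)"
    using finite_same_card_bij[of "A - S" "A - T"] assms(1) by auto
  define t where "t = (\<lambda>a. if a \<in> S then f a else if a \<in> A then g a else a)"
  have 1: "bij_betw t S T" using f by (rule bij_betw_cong[THEN iffD1, rotated]) (simp add: t_def)
  have 2: "bij_betw t (A - S) (A - T)"
    using g by (rule bij_betw_cong[THEN iffD1, rotated]) (simp add: t_def)
  have "bij_betw t (S \<union> (A - S)) (T \<union> (A - T))"
    using 1 2 by (rule bij_betw_combine) auto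
  moreover have "S \<union> (A - S) = A" "T \<union> (A - T) = A" using assms by auto
  ultimately have "bij_betw t A A" by simp
  then have "t permutes A"
    by (rule bij_imp_permutes) (use assms in \<open>auto simp: t_def\<close>)
  with 1 show ?thesis by (auto simp: bij_betw_def)
qed

lemma card_less_J_stat:
  assumes IN: "I < N" and h: "h \<le> I"
  shows "(N choose h) * card {p. p permutes {1..N} \<and> h < J_stat N I p} = fact N * (I choose h)"
proof -
  define low where "low = (\<lambda>p::nat\<Rightarrow>nat. {i\<in>{1..N}. p i \<le> h})"
  define P where "P = {p::nat\<Rightarrow>nat. p permutes {1..N}}"
  define c where "c = (\<lambda>S. card {p\<in>P. low p = S})"
  have finP: "finite P" unfolding P_def by (rule finite_permutations) simp
  have cle: "c S \<le> c T" if ST: "S \<subseteq> {1..N}" "T \<subseteq> {1..N}" "card S = card T" for S T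
  proof -
    obtain t where t: "t permutes {1..N}" "t ` T = S"
      using ex_permutes_image[OF finite_atLeastAtMost ST(2,1) ST(3)[symmetric]] by blast
    have tt: "t i \<in> S \<longleftrightarrow> i \<in> T" for i
      using t permutes_inj[OF t(1)] by (auto simp: inj_eq)
    have "low (p \<circ> t) = T" if "low p = S" for p
    proof -
      have "i \<in> low (p \<circ> t) \<longleftrightarrow> t i \<in> low p" for i
        using permutes_in_image[OF t(1), of i]
        unfolding low_def mem_Collect_eq comp_def by blast
      then show ?thesis unfolding that tt by (rule set_eqI)
    qed
    moreover have "p \<circ> t \<in> P" if "p \<in> P" for p
      using that permutes_compose[OF t(1), of p] by (simp add: P_def)
    ultimately have "(\<lambda>p. p \<circ> t) ` {p\<in>P. low p = S} \<subseteq> {p\<in>P. low p = T}"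
      by blast
    moreover have "inj_on (\<lambda>p. p \<circ> t) {p\<in>P. low p = S}"
    proof (rule inj_onI)
      fix p q assume "p \<circ> t = q \<circ> t"
      then have "p \<circ> (t \<circ> inv t) = q \<circ> (t \<circ> inv t)" by (simp only: comp_assoc[symmetric])
      then show "p = q" using permutes_inv_o(1)[OF t(1)] by simp
    qed
    ultimately show ?thesis unfolding c_def using finP by (intro card_inj_on_le) simp_all
  qed
  have count: "card {p\<in>P. low p \<subseteq> {1..M}} = (M choose h) * c {1..h}" if "M \<le> N" "h \<le> M" for M
  proof -
    define F where "F = {S. S \<subseteq> {1..M} \<and> card S = h}"
    have "{p\<in>P. low p \<subseteq> {1..M}} = (\<Union>S\<in>F. {p\<in>P. low p = S})"
    proof -
      have "card (low p) = h" if "p \<in> P" for p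
        using card_low_positions[of p N h] that IN h by (simp add: P_def low_def)
      then show ?thesis unfolding F_def by blast
    qed
    also have "card \<dots> = (\<Sum>S\<in>F. c S)"
      unfolding c_def
    proof (rule card_UN_disjoint)
      show "finite F" unfolding F_def by simp
      show "\<forall>S\<in>F. finite {p\<in>P. low p = S}" using finP by simp
      show "\<forall>S\<in>F. \<forall>T\<in>F. S \<noteq> T \<longrightarrow> {p\<in>P. low p = S} \<inter> {p\<in>P. low p = T} = {}" by blast
    qed
    also have "\<dots> = (\<Sum>S\<in>F. c {1..h})"
    proof (rule sum.cong[OF refl])
      fix S assume "S \<in> F"
      then have "S \<subseteq> {1..N}" "card S = card {1..h}" "{1..h} \<subseteq> {1..N}"
        using that by (auto simp: F_def)
      then show "c S = c {1..h}" using cle[of S "{1..h}"] cle[of "{1..h}" S] by simp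
    qed
    also have "\<dots> = (M choose h) * c {1..h}"
      unfolding F_def by (simp add: n_subsets)
    finally show ?thesis .
  qed
  have "{p\<in>P. low p \<subseteq> {1..N}} = P" by (auto simp: low_def)
  then have "fact N = (N choose h) * c {1..h}"
    using count[of N] IN h by (simp add: P_def card_permutations)
  moreover have "{p. p permutes {1..N} \<and> h < J_stat N I p} = {p\<in>P. low p \<subseteq> {1..I}}"
    using less_J_stat_iff[OF _ IN] by (auto simp: P_def low_def)
  then have "card {p. p permutes {1..N} \<and> h < J_stat N I p} = (I choose h) * c {1..h}"
    using count[of I] IN h by simp
  ultimately show ?thesis by simp
qed

lemma J_stat_le:
  assumes p: "p permutes {1..N}" and IN: "I < N"
  shows "J_stat N I p \<le> I + 1"
proof (rule ccontr)
  assume "\<not> ?thesis"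
  then have "{i\<in>{1..N}. p i \<le> I + 1} \<subseteq> {1..I}"
    by (subst less_J_stat_iff[OF assms, symmetric]) simp
  then have "card {i\<in>{1..N}. p i \<le> I + 1} \<le> card {1..I}"
    by (intro card_mono) auto
  then show False using card_low_positions[OF p, of "I + 1"] IN by simp
qed

lemma sum_R_prob:
  assumes IN: "I < N" and x: "0 \<le> x" "x < 1"
  shows "(\<Sum>p | p permutes {1..N}. R_prob N I x (J_stat N I p)) = 1"
proof -
  define P where "P = {p::nat\<Rightarrow>nat. p permutes {1..N}}"
  define w where "w = (\<lambda>h. real (N choose h) * x ^ h * (1 - x) ^ (N - h))"
  have finP: "finite P" unfolding P_def by (rule finite_permutations) simp
  have "(\<Sum>p\<in>P. \<Sum>h = 0..<J_stat N I p. w h)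
      = (\<Sum>p\<in>P. \<Sum>h\<in>{0..I}. if h < J_stat N I p then w h else 0)"
  proof (rule sum.cong[OF refl])
    fix p assume "p \<in> P"
    then have "{0..<J_stat N I p} = {h\<in>{0..I}. h < J_stat N I p}"
      using J_stat_le[of p N I] IN by (auto simp: P_def)
    then show "(\<Sum>h = 0..<J_stat N I p. w h)
        = (\<Sum>h\<in>{0..I}. if h < J_stat N I p then w h else 0)"
      by (simp only: sum.inter_filter[OF finite_atLeastAtMost])
  qed
  also have "\<dots> = (\<Sum>h\<in>{0..I}. \<Sum>p\<in>P. if h < J_stat N I p then w h else 0)"
    by (rule sum.swap)
  also have "\<dots> = (\<Sum>h\<in>{0..I}.
      fact N * (1 - x) ^ (N - I) * (real (I choose h) * x ^ h * (1 - x) ^ (I - h)))"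
  proof (rule sum.cong[OF refl])
    fix h assume h: "h \<in> {0..I}"
    have "(\<Sum>p\<in>P. if h < J_stat N I p then w h else 0)
        = real (card {p\<in>P. h < J_stat N I p}) * w h"
      using finP by (simp add: sum.inter_filter[symmetric])
    also have "\<dots> = real ((N choose h) * card {p. p permutes {1..N} \<and> h < J_stat N I p})
        * (x ^ h * (1 - x) ^ (N - h))"
      by (simp add: w_def P_def)
    also have "\<dots> = fact N * real (I choose h) * (x ^ h * (1 - x) ^ (N - h))"
      using h by (subst card_less_J_stat[OF IN]) auto
    also have "N - h = (N - I) + (I - h)" using h IN by simp
    finally show "(\<Sum>p\<in>P. if h < J_stat N I p then w h else 0)
        = fact N * (1 - x) ^ (N - I) * (real (I choose h) * x ^ h * (1 - x) ^ (I - h))"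
      by (simp add: power_add algebra_simps)
  qed
  also have "\<dots> = fact N * (1 - x) ^ (N - I) * (x + (1 - x)) ^ I"
    unfolding binomial_ring by (simp add: sum_distrib_left atMost_atLeast0)
  finally have "(\<Sum>p\<in>P. \<Sum>h = 0..<J_stat N I p. w h) = fact N * (1 - x) ^ (N - I)"
    by simp
  moreover have "R_prob N I x J = (\<Sum>h = 0..<J. w h) / (fact N * (1 - x) ^ (N - I))" for J
    by (simp add: R_prob_def w_def)
  ultimately show ?thesis
    using x by (simp only: P_def[symmetric] sum_divide_distrib[symmetric]) simp
qed

lemma R_prob_nonneg: "0 \<le> x \<Longrightarrow> x < 1 \<Longrightarrow> 0 \<le> R_prob N I x J"
  unfolding R_prob_def by (intro mult_nonneg_nonneg sum_nonneg) auto

lemma pmf_game_pmf: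
  assumes "I < N" "0 \<le> x" "x < 1"
  shows "pmf (game_pmf N I x) p =
           (if p permutes {1..N} then R_prob N I x (J_stat N I p) else 0)"
  unfolding game_pmf_def
proof (rule pmf_embed_pmf)
  let ?f = "\<lambda>p. if p permutes {1..N} then R_prob N I x (J_stat N I p) else 0"
  show "0 \<le> ?f p" for p using R_prob_nonneg assms by simp
  have "(\<integral>\<^sup>+ p. ennreal (?f p) \<partial>count_space UNIV)
      = (\<Sum>p | p permutes {1..N}. ennreal (?f p))"
    by (rule nn_integral_count_space') (auto intro: finite_permutations)
  also have "\<dots> = ennreal (\<Sum>p | p permutes {1..N}. ?f p)"
    using R_prob_nonneg assms by (intro sum_ennreal) auto
  also have "(\<Sum>p | p permutes {1..N}. ?f p) = 1"
    using sum_R_prob[OF assms] by simp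
  finally show "(\<integral>\<^sup>+ p. ennreal (?f p) \<partial>count_space UNIV) = 1" by simp
qed


subsection \<open>The maximum in \<^const>\<open>optimal_win_prob\<close> is over a finite set of values\<close>

lemma finite_range_win_prob:
  assumes "I < N" "0 \<le> x" "x < 1"
  shows "finite (range (win_prob N I x))"
proof -
  let ?S = "{p. p permutes {1..N}}"
  have "set_pmf (game_pmf N I x) \<subseteq> ?S"
    using pmf_game_pmf[OF assms] by (auto simp: set_pmf_eq split: if_splits)
  then have "win_prob N I x A = measure_pmf.prob (game_pmf N I x) ({p. wins N A p} \<inter> ?S)" for A
    unfolding win_prob_def
    by (intro measure_eq_AE) (auto simp: AE_measure_pmf_iff)
  then have "range (win_prob N I x) \<subseteq> measure_pmf.prob (game_pmf N I x) ` Pow ?S"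
    by auto
  moreover have "finite ?S" by (rule finite_permutations) simp
  ultimately show ?thesis by (meson finite_Pow_iff finite_imageI finite_subset)
qed

end

theory Submission
  imports Defs
begin

text \<open>
  Encode a permutation \<open>p\<close> by its prefix ranks \<open>r i = card {l \<le> i. p l \<le> p i}\<close>, which range
  freely over \<open>{1..i}\<close>.  Position \<open>m\<close> is a record iff \<open>r m = m\<close>, the value \<open>N\<close> sits at the last
  record, and \<open>J \<le> J_stat\<close> iff \<open>J \<le> r i\<close> for all \<open>i > I\<close>.

  Call a record \<open>m\<close> stopped if the player has accepted some record at a time \<open>\<le> m\<close>.  The number of
  stopped last records minus the number of stopped penultimate records telescopes to the indicator
  of winning.  Averaging over all continuations of a prefix turns this difference into
  \<open>Delta_dot\<close>, so every strategy earns the sum of \<open>Delta_dot\<close> over its stopped prefixes, and hence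
  at most the sum of the positive parts.  The strategy that accepts exactly the positive records
  attains this bound, provided that positivity persists at later records.

  Persistence in \<open>j\<close> is a sign-change argument.  For the step from \<open>k\<close> to \<open>k + 1\<close> the partial sums
  \<open>S\<close> of \<open>w J * a J\<close>, shifted so that the total vanishes, satisfy
  \<open>S J \<le> w J * (k - J) / (k + 1 - J)\<close>, and Abel summation gives the claim.  The comparison holds
  because the increments \<open>w J * D J\<close> of the difference change sign only once, from negative to
  positive; this uses \<open>J \<le> (N - J + 1)\<^sup>2\<close>, which is what the square-root hypothesis provides.
\<close>

subsection \<open>Persistence of positivity\<close>

lemma sum_inverse_shift:
  assumes "1 \<le> J" "J < k" "k < N"
  shows "(\<Sum>i = k - J..N - J - 1. 1 / real i) = (\<Sum>i = k - J + 1..N - J. 1 / real i) + 1 / real (k - J) - 1 / real (N - J)"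
proof -
  have "(\<Sum>i = k - J..N - J. 1 / real i) = 1 / real (k - J) + (\<Sum>i = k - J + 1..N - J. 1 / real i)"
    using assms by (subst sum.atLeast_Suc_atMost) auto
  moreover have "(\<Sum>i = k - J..N - J. 1 / real i) = (\<Sum>i = k - J..N - J - 1. 1 / real i) + 1 / real (N - J)"
    using assms by (cases "N - J") auto
  ultimately show ?thesis by simp
qed

text \<open>Clearing denominators reduces the inequality to \<open>h + 1 \<le> m\<^sup>2\<close>.
  With \<open>h = J - 1\<close> and \<open>m = N - J + 1\<close> this becomes
  \<open>J \<le> (N - J + 1)\<^sup>2\<close>.\<close>

lemma slope_increment:
  fixes h m :: real
  assumes "0 \<le> h" "1 < m" "h + 1 \<le> m\<^sup>2"
  shows "h * m / (m + 1) \<le> (h + 1) * (m - 1) / m"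
proof -
  have "h * m * m \<le> (h + 1) * (m - 1) * (m + 1)"
    using assms(3) by (simp add: algebra_simps power2_eq_square)
  then show ?thesis using assms by (simp add: field_simps)
qed

text \<open>From \<open>J\<close> to \<open>Suc J\<close> the term \<open>u * g\<close> grows by at
  least the fraction \<open>1 / q\<close> of itself, while the harmonic sum \<open>s\<close> grows
  by at most the fraction \<open>1 / q\<close> of \<open>s J\<close>. Once \<open>u * g J\<close>
  has reached \<open>s J + d\<close>, it stays ahead.\<close>

lemma sign_propagates:
  fixes u d :: real
  assumes J: "1 \<le> J" "J < k" "k < N" and u: "0 < u" and d: "0 \<le> d"
    and sq: "J \<le> (N - J + 1)\<^sup>2"
  defines "g \<equiv> \<lambda>J::nat. (real J - 1) * (real N - J + 1) / ((real N - J + 2) * (real k - J + 2))"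
    and "s \<equiv> \<lambda>J. \<Sum>i = k - J + 2..N - J. 1 / real i"
  assumes D: "0 \<le> u * g J - s J - d"
  shows "0 \<le> u * g (Suc J) - s (Suc J) - d"
proof -
  define q where "q = real k - J + 1"
  have q: "0 < q" using J by (simp add: q_def)
  have real_NJ: "real (N - J) = real N - J" using J by simp
  have "real J \<le> (real (N - J + 1))\<^sup>2"
    using sq by (simp only: of_nat_power[symmetric] of_nat_le_iff)
  then have "(real J - 1) * (real N - J + 1) / ((real N - J + 1) + 1)
      \<le> (real J - 1 + 1) * ((real N - J + 1) - 1) / (real N - J + 1)"
    using J by (intro slope_increment) (auto simp: real_NJ add.commute)
  moreover have "g J * (q + 1) = (real J - 1) * (real N - J + 1) / ((real N - J + 1) + 1)"
  proof -
    have eqs: "real k - J + 2 = q + 1" "q + 1 \<noteq> 0" "real N - J + 2 = (real N - J + 1) + 1"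
      using q by (simp_all add: q_def)
    show ?thesis unfolding g_def eqs(1,3) using eqs(2) by simp
  qed
  moreover have "g (Suc J) * q = (real J - 1 + 1) * ((real N - J + 1) - 1) / (real N - J + 1)"
  proof -
    have "real k - Suc J + 2 = q" "real N - Suc J + 2 = real N - J + 1" "real N - Suc J + 1 = real N - J"
      by (simp_all add: q_def)
    then show ?thesis using q by (simp add: g_def)
  qed
  ultimately have "g J * (q + 1) \<le> g (Suc J) * q" by simp
  then have "g J * (q + 1) / q \<le> g (Suc J)" using q by (simp add: field_simps)
  moreover have "g J * (q + 1) / q = g J + g J / q" using q by (simp add: field_simps)
  ultimately have "u * (g J + g J / q) \<le> u * g (Suc J)" using u by (intro mult_left_mono) auto
  then have 1: "u * g J + u * g J / q \<le> u * g (Suc J)" by (simp add: algebra_simps)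
  \<comment> \<open>The sum \<open>s J\<close> has \<open>N - k - 1\<close> terms, each at least
    \<open>1 / (real N - J)\<close>.\<close>
  have "real (N - k - 1) / (real N - J) = (\<Sum>i = k - J + 2..N - J. 1 / (real N - J))"
    using J by (simp add: Suc_diff_Suc)
  also have "\<dots> \<le> s J"
    unfolding s_def using J by (intro sum_mono) (auto simp: frac_le)
  finally have "real (N - k - 1) / (real N - J) \<le> u * g J" using D d by linarith
  then have 2: "real (N - k - 1) / (real N - J) / q \<le> u * g J / q"
    using q by (intro divide_right_mono) auto
  \<comment> \<open>Sliding the window of summation down by one gains \<open>1 / q\<close> and loses
    \<open>1 / (real N - J)\<close>; for \<open>N = Suc k\<close> both windows are empty.\<close>
  have 3: "s (Suc J) - s J = real (N - k - 1) / (real N - J) / q"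
  proof (cases "N = Suc k")
    case True
    then show ?thesis using J by (simp add: s_def)
  next
    case False
    then have "Suc k < N" using J by simp
    then have "s (Suc J) = s J + 1 / real (k - J + 1) - 1 / real (N - J)"
      using sum_inverse_shift[of J "Suc k" N] J by (simp add: s_def Suc_diff_le Suc_diff_Suc)
    moreover have "1 / real (k - J + 1) - 1 / real (N - J) = real (N - k - 1) / (real N - J) / q"
      using J by (simp add: q_def field_simps)
    ultimately show ?thesis by simp
  qed
  show ?thesis using 1 2 3 D by linarith
qed

text \<open>\<open>w\<close> and \<open>a\<close> stand for weights and advantages at size
  \<open>k\<close>; passing to \<open>k + 1\<close> multiplies \<open>w J\<close> by
  \<open>y J\<close> and adds \<open>y J\<close> to \<open>a J\<close>. The increasing factors
  \<open>y\<close> shift weight towards large \<open>J\<close>, where \<open>a\<close> is smaller,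
  and the gain \<open>y J\<close> in \<open>a J\<close> has to make up for that.\<close>

lemma sum_nonneg_advance:
  fixes w :: "nat \<Rightarrow> real"
  assumes j: "1 \<le> j" "j \<le> k" "k < N" and u: "0 < u"
    and sq: "\<And>J. 1 \<le> J \<Longrightarrow> J < j \<Longrightarrow> J \<le> (N - J + 1)\<^sup>2"
    and wpos: "\<And>J. 1 \<le> J \<Longrightarrow> J \<le> j \<Longrightarrow> 0 < w J"
    and wrec: "\<And>J. 1 \<le> J \<Longrightarrow> J < j \<Longrightarrow>
      w J * (real N - J + 1) * (real k - J) = u * w (Suc J) * J * (real N - J)"
  defines "a \<equiv> \<lambda>J. 1 - (\<Sum>i = k - J + 1..N - J. 1 / real i)"
    and "y \<equiv> \<lambda>J::nat. 1 / (real k + 1 - J)"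
  assumes S: "0 \<le> (\<Sum>J = 1..j. w J * a J)"
  shows "0 \<le> (\<Sum>J = 1..j. w J * y J * (a J + y J))"
proof -
  \<comment> \<open>The weighted mean of \<open>a\<close>. Centering at it makes the last partial
    sum vanish, which removes the boundary term \<open>S' j * y j\<close>; being nonnegative,
    \<open>d\<close> can be added back at the end.\<close>
  define d where "d = (\<Sum>J = 1..j. w J * a J) / (\<Sum>J = 1..j. w J)"
  have W: "0 < (\<Sum>J = 1..j. w J)" using j wpos by (intro sum_pos) auto
  have d: "0 \<le> d" using S W by (simp add: d_def)
  define S' where "S' = (\<lambda>n. \<Sum>J = 1..n. w J * (a J - d))"
  have S'j: "S' j = 0"
  proof -
    have "S' j = (\<Sum>J = 1..j. w J * a J) - (\<Sum>J = 1..j. w J) * d"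
      by (simp only: S'_def right_diff_distrib sum_subtractf sum_distrib_right)
    then show ?thesis using W unfolding d_def by simp
  qed
  \<comment> \<open>Equals \<open>1 - y J\<close>, and satisfies
    \<open>C n * y (Suc n) = y n\<close>. With this factor, \<open>S' n \<le> C n * w n\<close> is
    precisely the bound that one step of the Abel summation consumes.\<close>
  define C where "C = (\<lambda>J::nat. (real k - J) / (real k + 1 - J))"
  define E where "E = (\<lambda>n. S' n - C n * w n)"
  define g where "g = (\<lambda>J::nat. (real J - 1) * (real N - J + 1) / ((real N - J + 2) * (real k - J + 2)))"
  define s where "s = (\<lambda>J. \<Sum>i = k - J + 2..N - J. 1 / real i)"
  define D where "D = (\<lambda>J. u * g J - s J - d)"
  have aC: "a J - C J = - s J" if "1 \<le> J" "J \<le> j" for J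
  proof -
    have "(\<Sum>i = k - J + 1..N - J. 1 / real i) = 1 / real (k - J + 1) + s J"
      unfolding s_def using that j by (subst sum.atLeast_Suc_atMost) auto
    moreover have "C J = 1 - 1 / real (k - J + 1)"
      using that j by (simp add: C_def field_simps)
    ultimately show ?thesis by (simp add: a_def)
  qed
  have E1: "E 1 = w 1 * D 1"
  proof -
    have "E 1 = w 1 * (a 1 - C 1 - d)" by (simp add: E_def S'_def algebra_simps)
    also have "a 1 - C 1 - d = D 1" using aC[of 1] j by (simp add: D_def g_def)
    finally show ?thesis .
  qed
  have Estep: "E (Suc n) = E n + w (Suc n) * D (Suc n)" if n: "1 \<le> n" "n < j" for n
  proof -
    \<comment> \<open>Expanding by \<open>real N - n + 1\<close> lets \<open>wrec\<close> express
      \<open>C n * w n\<close> through \<open>w (Suc n)\<close>, so that the whole increment of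
      \<open>E\<close> has the positive factor \<open>w (Suc n)\<close>.\<close>
    have "C n * w n = w n * (real N - n + 1) * (real k - n) / ((real k + 1 - n) * (real N - n + 1))"
      using n j by (simp add: C_def)
    also have "\<dots> = w (Suc n) * (u * g (Suc n))"
      unfolding wrec[OF n] using n j by (simp add: g_def algebra_simps)
    finally have "E (Suc n) - E n = w (Suc n) * (a (Suc n) - d - C (Suc n) + u * g (Suc n))"
      using n by (simp add: E_def S'_def algebra_simps)
    also have "a (Suc n) - d - C (Suc n) + u * g (Suc n) = D (Suc n)"
      using aC[of "Suc n"] n by (simp add: D_def)
    finally show ?thesis by simp
  qed
  have D1: "D 1 \<le> 0"
  proof -
    have "0 \<le> s 1" unfolding s_def by (intro sum_nonneg) auto
    then show ?thesis using d by (simp add: D_def g_def)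
  qed
  have Dup: "0 \<le> D (Suc n)" if n: "1 \<le> n" "n < j" "0 \<le> D n" for n
    using sign_propagates[of n k N u d] n j u d sq[OF n(1,2)]
    unfolding D_def g_def s_def by simp
  have Ej: "E j \<le> 0"
    using S'j wpos[of j] j by (simp add: E_def C_def)
  \<comment> \<open>\<open>E\<close> starts nonpositive and does not rise until \<open>D\<close>
    first becomes nonnegative; from then on it does not fall and ends at \<open>E j \<le> 0\<close>.
    Which of the two phases contains \<open>n\<close> decides the side from which it is
    bounded.\<close>
  have E: "E n \<le> 0" if n: "1 \<le> n" "n \<le> j" for n
  proof (cases "\<exists>m\<in>{1..n}. 0 \<le> D m")
    case True
    then obtain m where m: "1 \<le> m" "m \<le> n" "0 \<le> D m" by auto
    have Dm: "0 \<le> D l" if "m \<le> l" "l \<le> j" for l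
      using that by (induction rule: dec_induct) (use m Dup in auto)
    have "E n \<le> E j"
      using n(2)
    proof (induction rule: dec_induct)
      case (step l)
      then have "0 \<le> w (Suc l) * D (Suc l)"
        using Dm[of "Suc l"] wpos[of "Suc l"] m n by (intro mult_nonneg_nonneg) auto
      then show ?case using Estep[of l] step n by simp
    qed simp
    with Ej show ?thesis by simp
  next
    case False
    have "E l \<le> 0" if "1 \<le> l" "l \<le> n" for l
      using that
    proof (induction rule: dec_induct)
      case base
      show ?case using E1 D1 wpos[of 1] j by (simp add: mult_le_0_iff)
    next
      case (step l)
      then have "Suc l \<in> {1..n}" by simp
      then have "D (Suc l) \<le> 0" using False by (meson linear)
      then have "w (Suc l) * D (Suc l) \<le> 0"
        using wpos[of "Suc l"] step n by (simp add: mult_le_0_iff)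
      then show ?case using Estep[of l] step n by simp
    qed
    then show ?thesis using n by simp
  qed
  \<comment> \<open>The inductive step needs
    \<open>S' n * (y (Suc n) - y n) \<le> w n * (y n)\<^sup>2\<close>, which is the bound on
    \<open>E n\<close> multiplied by \<open>y n * y (Suc n)\<close>.\<close>
  have Abel: "S' n * y n + w n * (y n)\<^sup>2 \<le> (\<Sum>J = 1..n. w J * y J * (a J - d + y J))"
    if "1 \<le> n" "n \<le> j" for n
    using that
  proof (induction rule: dec_induct)
    case base
    show ?case by (simp add: S'_def power2_eq_square algebra_simps)
  next
    case (step n)
    have yy: "y (Suc n) - y n = y n * y (Suc n)" "C n * y (Suc n) = y n"
      using step j by (simp_all add: y_def C_def field_simps)
    have ypos: "0 \<le> y n * y (Suc n)" using step j by (simp add: y_def)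
    have "S' n \<le> C n * w n" using E[of n] step by (simp add: E_def)
    then have "S' n * (y n * y (Suc n)) \<le> C n * w n * (y n * y (Suc n))"
      using ypos by (intro mult_right_mono)
    also have "\<dots> = w n * y n * (C n * y (Suc n))" by simp
    finally have "S' n * (y (Suc n) - y n) \<le> w n * (y n)\<^sup>2"
      unfolding yy by (simp add: power2_eq_square)
    then have "S' n * y (Suc n) \<le> S' n * y n + w n * (y n)\<^sup>2" by (simp add: algebra_simps)
    moreover have "S' (Suc n) = S' n + w (Suc n) * (a (Suc n) - d)"
      by (simp add: S'_def)
    then have "S' (Suc n) * y (Suc n) = S' n * y (Suc n) + w (Suc n) * y (Suc n) * (a (Suc n) - d)"
      by (simp only: distrib_right) simp
    ultimately show ?case
      using step by (simp add: distrib_left power2_eq_square)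
  qed
  have "0 \<le> S' j * y j + w j * (y j)\<^sup>2"
    using S'j wpos[of j] j by simp
  also have "\<dots> \<le> (\<Sum>J = 1..j. w J * y J * (a J - d + y J))"
    using Abel j by simp
  also have "\<dots> \<le> (\<Sum>J = 1..j. w J * y J * (a J + y J))"
    using wpos d j by (intro sum_mono mult_left_mono mult_nonneg_nonneg) (auto simp: y_def intro: less_imp_le)
  finally show ?thesis .
qed

text \<open>After the shift \<open>m = i + J\<close> the range does not depend on \<open>J\<close>:
  sums for different \<open>J\<close> can be compared term by term, and those for \<open>k\<close>
  and \<open>Suc k\<close> differ by the first term only.\<close>

lemma sum_inverse_reindex:
  assumes "J \<le> k"
  shows "(\<Sum>i = k - J + 1..N - J. 1 / real i) = (\<Sum>m = k + 1..N. 1 / (real m - J))"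
  by (rule sum.reindex_bij_witness[of _ "\<lambda>m. m - J" "\<lambda>i. i + J"]) (use assms in auto)

text \<open>If \<open>a i\<close> is nonnegative, so are all earlier values. Otherwise the discarded
  terms are all nonpositive, and omitting them does not lower the sum.\<close>

lemma sum_truncate_nonneg:
  fixes w a :: "nat \<Rightarrow> real"
  assumes "1 \<le> i" "i \<le> j"
    and w: "\<And>J. 1 \<le> J \<Longrightarrow> J \<le> j \<Longrightarrow> 0 \<le> w J"
    and a: "\<And>J K. 1 \<le> J \<Longrightarrow> J \<le> K \<Longrightarrow> K \<le> j \<Longrightarrow> a K \<le> a J"
    and S: "0 \<le> (\<Sum>J = 1..j. w J * a J)"
  shows "0 \<le> (\<Sum>J = 1..i. w J * a J)"
proof (cases "0 \<le> a i")
  case True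
  have "0 \<le> a J" if "J \<in> {1..i}" for J using a[of J i] True that assms(2) by simp
  then show ?thesis using assms by (intro sum_nonneg mult_nonneg_nonneg) auto
next
  case False
  have "(\<Sum>J = 1..j. w J * a J) \<le> (\<Sum>J = 1..i. w J * a J) + 0"
  proof -
    have "(\<Sum>J = 1..j. w J * a J) = (\<Sum>J = 1..i. w J * a J) + (\<Sum>J = i + 1..j. w J * a J)"
      using sum.ub_add_nat[of 1 i "\<lambda>J. w J * a J" "j - i"] assms by simp
    moreover have "w J * a J \<le> 0" if "J \<in> {i + 1..j}" for J
      using a[of i J] False that assms(1) w[of J] by (simp add: mult_le_0_iff)
    then have "(\<Sum>J = i + 1..j. w J * a J) \<le> 0" by (rule sum_nonpos)
    ultimately show ?thesis by simp
  qed
  then show ?thesis using S by simp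
qed

section \<open>Persistence for \<open>Delta_dot\<close> at sizes beyond \<open>I\<close>\<close>

definition advantage :: "nat \<Rightarrow> nat \<Rightarrow> nat \<Rightarrow> real" where
  "advantage N k J = 1 - (\<Sum>i = k - J + 1..N - J. 1 / real i)"

definition stop_weight :: "nat \<Rightarrow> nat \<Rightarrow> real \<Rightarrow> nat \<Rightarrow> nat \<Rightarrow> real" where
  "stop_weight N I x k J = sigma_dot N I k J * R_dot I x J"

text \<open>Beyond \<open>I\<close>, \<open>tau_dot\<close> is \<open>sigma_dot\<close> times a
  harmonic sum. Each term therefore factors into a weight and an advantage, and \<open>j\<close>
  enters only as the cut-off of the sum.\<close>

lemma dot_R_Delta_dot:
  assumes "I < k" "j \<le> I + 1"
  shows "dot_R I x (Delta_dot N I k j) = (\<Sum>J = 1..j. stop_weight N I x k J * advantage N k J)"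
proof -
  have "dot_R I x (Delta_dot N I k j) =
      (\<Sum>J = 1..I + 1. if J \<in> {1..j} then stop_weight N I x k J * advantage N k J else 0)"
    unfolding dot_R_def
    by (intro sum.cong)
       (use assms in \<open>auto simp: Delta_dot_def tau_dot_def stop_weight_def advantage_def algebra_simps\<close>)
  also have "\<dots> = (\<Sum>J \<in> {1..I + 1} \<inter> {1..j}. stop_weight N I x k J * advantage N k J)"
    by (simp only: sum.inter_restrict finite_atLeastAtMost)
  also have "{1..I + 1} \<inter> {1..j} = {1..j}" using assms by auto
  finally show ?thesis .
qed

lemma advantage_antimono:
  assumes "J \<le> K" "K \<le> k"
  shows "advantage N k K \<le> advantage N k J"
proof -
  have "(\<Sum>m = k + 1..N. 1 / (real m - J)) \<le> (\<Sum>m = k + 1..N. 1 / (real m - K))"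
    using assms by (intro sum_mono divide_left_mono mult_pos_pos) auto
  moreover have "J \<le> k" using assms by simp
  ultimately show ?thesis using assms(2) unfolding advantage_def by (simp only: sum_inverse_reindex)
qed

lemma advantage_Suc:
  assumes "J \<le> k" "k < N"
  shows "advantage N (Suc k) J = advantage N k J + 1 / (real k + 1 - J)"
proof -
  have "(\<Sum>m = k + 1..N. 1 / (real m - J)) = 1 / (real k + 1 - J) + (\<Sum>m = Suc k + 1..N. 1 / (real m - J))"
    using assms by (subst sum.atLeast_Suc_atMost) (auto simp: add.commute)
  moreover have "J \<le> Suc k" using assms by simp
  ultimately show ?thesis using assms(1) unfolding advantage_def by (simp only: sum_inverse_reindex)
qed

lemma stop_weight_nonneg: "I < k \<Longrightarrow> 0 \<le> x \<Longrightarrow> x < 1 \<Longrightarrow> 0 \<le> stop_weight N I x k J"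
  by (simp add: stop_weight_def sigma_dot_def R_dot_def)

lemma stop_weight_Suc:
  assumes "I < k" "J \<le> k"
  shows "stop_weight N I x (Suc k) J = stop_weight N I x k J * (1 / (real k + 1 - J))"
  using assms by (simp add: stop_weight_def sigma_dot_def Suc_diff_le)

text \<open>Supplies \<open>wrec\<close> of \<open>sum_nonneg_advance\<close> with
  \<open>u = (1 - x) / x\<close>, by multiplying the ratios of consecutive binomials, factorials and
  values of \<open>R_dot\<close>.\<close>

lemma stop_weight_rec:
  assumes J: "1 \<le> J" "J \<le> I" "I < k" "k \<le> N" and x: "0 < x" "x < 1"
  shows "stop_weight N I x k J * (real N - J + 1) * (real k - J)
       = (1 - x) / x * stop_weight N I x k (Suc J) * J * (real N - J)"
proof -
  obtain h where h: "J = Suc h" using J(1) by (cases J) auto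
  have R: "R_dot I x (Suc J) * (1 - x) = R_dot I x J * x"
  proof -
    have "I - h = Suc (I - J)" using J h by simp
    then show ?thesis by (simp add: R_dot_def h)
  qed
  have bin: "real (N choose J) * J = real (N choose (J - 1)) * (real N - J + 1)"
  proof -
    have "J * (N choose J) = (N - h) * (N choose h)"
      by (simp only: h binomial_absorption binomial_absorb_comp)
    then have "real J * real (N choose J) = real (N - h) * real (N choose h)"
      by (simp only: of_nat_mult[symmetric])
    then show ?thesis using h J by (simp add: algebra_simps)
  qed
  have fN: "fact (N - J) = (real N - J) * fact (N - Suc J)"
    using J fact_reduce[of "N - J", where 'a=real] by simp
  have fk: "fact (k - J) = (real k - J) * fact (k - Suc J)"
    using J fact_reduce[of "k - J", where 'a=real] by simp
  have kJ: "real k - J \<noteq> 0" using J by simp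
  have "stop_weight N I x k J * (real N - J + 1) * (real k - J)
      = (real (N choose (J - 1)) * (real N - J + 1)) * (real N - J) * fact (N - Suc J) / fact (k - Suc J) * R_dot I x J"
    using J kJ by (simp add: stop_weight_def sigma_dot_def fN fk)
  also have "R_dot I x J = (1 - x) / x * R_dot I x (Suc J)"
    using R x by (simp add: field_simps)
  finally show ?thesis
    using J unfolding bin[symmetric] by (simp add: stop_weight_def sigma_dot_def mult_ac)
qed

lemma Delta_dot_nonneg_Suc:
  assumes k: "I < k" "k < N" and x: "0 \<le> x" "x < 1" and j: "1 \<le> j" "j \<le> I + 1"
    and sq: "I + 1 \<le> (N - I)\<^sup>2"
    and S: "0 \<le> dot_R I x (Delta_dot N I k j)"
  shows "0 \<le> dot_R I x (Delta_dot N I (Suc k) j)"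
proof (cases "x = 0")
  case True
  let ?w = "stop_weight N I x" and ?a = "advantage N"
  \<comment> \<open>At \<open>x = 0\<close> the ratio \<open>(1 - x) / x\<close> is meaningless.
    Here \<open>R_dot\<close> vanishes except at \<open>J = 1\<close>, where
    \<open>0 ^ 0 = 1\<close>, so a single advantage, increasing in the size, decides the
    sign.\<close>
  have w1: "?w k' J * ?a k' J = (if J = 1 then ?w k' 1 * ?a k' 1 else 0)" if "1 \<le> J" for J k'
    using that True by (auto simp: stop_weight_def R_dot_def power_0_left)
  then have eq: "dot_R I x (Delta_dot N I k' j) = ?w k' 1 * ?a k' 1" if "I < k'" for k'
  proof -
    have "dot_R I x (Delta_dot N I k' j) = (\<Sum>J = 1..j. if J = 1 then ?w k' 1 * ?a k' 1 else 0)"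
      unfolding dot_R_Delta_dot[OF that j(2)] by (rule sum.cong) (use w1 in auto)
    also have "\<dots> = ?w k' 1 * ?a k' 1" using j(1) by (subst sum.delta) auto
    finally show ?thesis .
  qed
  have "0 < ?w k 1"
    using k True by (simp add: stop_weight_def sigma_dot_def R_dot_def)
  then have "0 \<le> ?a k 1" using S eq[of k] k by (simp add: zero_le_mult_iff)
  then have "0 \<le> ?a (Suc k) 1" using advantage_Suc[of 1 k N] k by simp
  then show ?thesis using eq[of "Suc k"] k stop_weight_nonneg[of I "Suc k" x N 1] x by simp
next
  case False
  then have x: "0 < x" "x < 1" using x by auto
  let ?w = "stop_weight N I x k" and ?y = "\<lambda>J::nat. 1 / (real k + 1 - J)"
  have "0 \<le> (\<Sum>J = 1..j. ?w J * ?y J * (advantage N k J + ?y J))"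
    unfolding advantage_def
  proof (rule sum_nonneg_advance[where u = "(1 - x) / x"])
    fix J assume J: "1 \<le> J" "J < j"
    have "(N - I)\<^sup>2 \<le> (N - J + 1)\<^sup>2" using J j by (intro power_mono) auto
    then show "J \<le> (N - J + 1)\<^sup>2" using sq J j by linarith
    show "?w J * (real N - J + 1) * (real k - J) = (1 - x) / x * ?w (Suc J) * J * (real N - J)"
      using J j k x by (intro stop_weight_rec) auto
  next
    fix J assume "1 \<le> J" "J \<le> j"
    then show "0 < ?w J"
      using x j k by (simp add: stop_weight_def sigma_dot_def R_dot_def)
  next
    show "0 \<le> (\<Sum>J = 1..j. ?w J * (1 - (\<Sum>i = k - J + 1..N - J. 1 / real i)))"
      using S k j by (simp add: dot_R_Delta_dot advantage_def)
  qed (use j k x in auto)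
  also have "\<dots> = dot_R I x (Delta_dot N I (Suc k) j)"
    using j k by (auto simp: dot_R_Delta_dot advantage_Suc stop_weight_Suc intro!: sum.cong)
  finally show ?thesis .
qed

text \<open>As play continues the size grows and the J-statistic of the prefix can only drop, so
  both changes are covered. The sum is first truncated at \<open>j'\<close> for fixed
  \<open>k\<close>; then the size is advanced.\<close>

lemma Delta_dot_nonneg_mono:
  assumes "I < k" "k \<le> k'" "k' \<le> N" and x: "0 \<le> x" "x < 1"
    and j: "1 \<le> j'" "j' \<le> j" "j \<le> I + 1"
    and sq: "I + 1 \<le> (N - I)\<^sup>2"
    and S: "0 \<le> dot_R I x (Delta_dot N I k j)"
  shows "0 \<le> dot_R I x (Delta_dot N I k' j')"
proof -
  have "0 \<le> dot_R I x (Delta_dot N I k j')"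
  proof -
    have "0 \<le> (\<Sum>J = 1..j'. stop_weight N I x k J * advantage N k J)"
    proof (rule sum_truncate_nonneg[OF j(1,2)])
      fix J K assume "1 \<le> J" "J \<le> K" "K \<le> j"
      then show "advantage N k K \<le> advantage N k J"
        using assms by (intro advantage_antimono) auto
    qed (use assms stop_weight_nonneg dot_R_Delta_dot in auto)
    then show ?thesis using assms by (simp add: dot_R_Delta_dot)
  qed
  with assms(2) show ?thesis
    using assms(3)
  proof (induction rule: dec_induct)
    case (step n)
    then show ?case using Delta_dot_nonneg_Suc[of I n N x j'] assms by simp
  qed
qed

text \<open>With \<open>d = N - I\<close> the hypothesis reads
  \<open>sqrt (N + 5 / 4) \<le> d + 1 / 2\<close>; squaring gives
  \<open>N + 1 \<le> d\<^sup>2 + d\<close>, and subtracting \<open>d\<close> finishes.\<close>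

lemma square_bound:
  assumes "I < N" "real I \<le> real N - sqrt (real N + 5 / 4) + 1 / 2"
  shows "I + 1 \<le> (N - I)\<^sup>2"
proof -
  define d where "d = real (N - I)"
  have "sqrt (real N + 5 / 4) \<le> d + 1 / 2" using assms by (simp add: d_def)
  then have "real N + 5 / 4 \<le> (d + 1 / 2)\<^sup>2"
    by (rule sqrt_le_D)
  then have "real N + 1 \<le> d\<^sup>2 + d" by (simp add: power2_eq_square algebra_simps)
  then have "real (I + 1) \<le> real ((N - I)\<^sup>2)" using assms(1) by (simp add: d_def)
  then show ?thesis by (simp only: of_nat_le_iff)
qed

subsection \<open>Prefix ranks\<close>

definition prefix_rank :: "(nat \<Rightarrow> nat) \<Rightarrow> nat \<Rightarrow> nat" where
  "prefix_rank p i = card {l \<in> {1..i}. p l \<le> p i}"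

text \<open>A variant of Lehmer codes. Extensionality makes a code carry no data beyond its first
  \<open>n\<close> ranks, so that there are exactly \<open>fact n\<close> of them.\<close>

definition codes :: "nat \<Rightarrow> (nat \<Rightarrow> nat) set" where
  "codes n = (\<Pi>\<^sub>E i\<in>{1..n}. {1..i})"

lemma prefix_rank_in_range:
  assumes "1 \<le> i"
  shows "prefix_rank p i \<in> {1..i}"
proof -
  have "{i} \<subseteq> {l \<in> {1..i}. p l \<le> p i}" using assms by auto
  then have "card {i} \<le> prefix_rank p i" unfolding prefix_rank_def by (intro card_mono) auto
  moreover have "prefix_rank p i \<le> card {1..i}" unfolding prefix_rank_def by (intro card_mono) auto
  ultimately show ?thesis by simp
qed

lemma prefix_rank_eq_self_iff: "1 \<le> m \<Longrightarrow> prefix_rank p m = m \<longleftrightarrow> (\<forall>l\<in>{1..m}. p l \<le> p m)"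
proof
  assume m: "1 \<le> m" "prefix_rank p m = m"
  then have "{l \<in> {1..m}. p l \<le> p m} = {1..m}"
    by (intro card_subset_eq) (auto simp: prefix_rank_def)
  then show "\<forall>l\<in>{1..m}. p l \<le> p m" by blast
next
  assume "\<forall>l\<in>{1..m}. p l \<le> p m"
  then have "{l \<in> {1..m}. p l \<le> p m} = {1..m}" by blast
  then show "prefix_rank p m = m" by (simp add: prefix_rank_def)
qed

text \<open>Induction on \<open>n\<close>: the last rank says how many earlier values lie below the
  new one, which fixes where the new value is inserted into the order already known.\<close>

lemma order_determined_by_prefix_ranks:
  fixes p q :: "nat \<Rightarrow> nat"
  assumes "inj p" "inj q" "\<And>i. i \<in> {1..n} \<Longrightarrow> prefix_rank p i = prefix_rank q i"
  shows "i \<in> {1..n} \<Longrightarrow> l \<in> {1..n} \<Longrightarrow> p l \<le> p i \<longleftrightarrow> q l \<le> q i"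
  using assms(3)
proof (induction n arbitrary: i l)
  case (Suc n)
  have IH: "p l \<le> p i \<longleftrightarrow> q l \<le> q i" if "i \<in> {1..n}" "l \<in> {1..n}" for i l
    using Suc that by simp
  define L where "L = (\<lambda>f::nat \<Rightarrow> nat. {l \<in> {1..n}. f l \<le> f (Suc n)})"
  have fin: "finite (L f)" for f by (simp add: L_def)
  have "prefix_rank f (Suc n) = Suc (card (L f))" for f
  proof -
    have "{l \<in> {1..Suc n}. f l \<le> f (Suc n)} = insert (Suc n) (L f)"
      by (auto simp: L_def)
    then show ?thesis by (simp add: prefix_rank_def L_def)
  qed
  then have card: "card (L p) = card (L q)" using Suc.prems(3)[of "Suc n"] by simp
  \<comment> \<open>By the induction hypothesis \<open>p\<close> and \<open>q\<close> order
    \<open>{1..n}\<close> alike. Both sets are initial segments of that order, hence nested, and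
    equal cardinality makes them equal.\<close>
  have "L p \<subseteq> L q \<or> L q \<subseteq> L p"
  proof (rule ccontr)
    assume "\<not> ?thesis"
    then obtain a b where ab: "a \<in> L p" "a \<notin> L q" "b \<in> L q" "b \<notin> L p" by blast
    then have "a \<in> {1..n}" "b \<in> {1..n}" "p a \<le> p b" "q b \<le> q a" "a \<noteq> b" by (auto simp: L_def)
    then show False using IH[of b a] IH[of a b] injD[OF assms(2), of a b] by auto
  qed
  then have "L p = L q" using card fin by (metis card_subset_eq)
  then have top: "p l \<le> p (Suc n) \<longleftrightarrow> q l \<le> q (Suc n)" if "l \<in> {1..n}" for l
    using that by (auto simp: L_def)
  have top': "p (Suc n) \<le> p l \<longleftrightarrow> q (Suc n) \<le> q l" if "l \<in> {1..n}" for l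
    using top[OF that] that injD[OF assms(1), of l "Suc n"] injD[OF assms(2), of l "Suc n"]
    by (metis atLeastAtMost_iff le_antisym nat_le_linear not_less_eq_eq)
  show ?case
    using Suc.prems(1,2) IH[of i l] top[of l] top'[of i] by (auto simp: le_Suc_eq)
qed simp

lemma prefix_flattening_le_iff:
  assumes "i \<in> {1..k}" "l \<in> {1..k}"
  shows "prefix_flattening k p l \<le> prefix_flattening k p i \<longleftrightarrow> p l \<le> p i"
proof
  assume "p l \<le> p i"
  then show "prefix_flattening k p l \<le> prefix_flattening k p i"
    unfolding prefix_flattening_def using assms by (auto intro!: card_mono)
next
  assume le: "prefix_flattening k p l \<le> prefix_flattening k p i"
  show "p l \<le> p i"
  proof (rule ccontr)
    assume "\<not> p l \<le> p i"
    then have "{m \<in> {1..k}. p m \<le> p i} \<subset> {m \<in> {1..k}. p m \<le> p l}"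
      using assms by fastforce
    then have "card {m \<in> {1..k}. p m \<le> p i} < card {m \<in> {1..k}. p m \<le> p l}"
      by (intro psubset_card_mono) auto
    then show False using le assms by (simp add: prefix_flattening_def)
  qed
qed

text \<open>The player's information after \<open>k\<close> steps is therefore the list of the first
  \<open>k\<close> ranks.\<close>

lemma prefix_flattening_eq_iff:
  assumes "inj p" "inj q"
  shows "prefix_flattening k p = prefix_flattening k q \<longleftrightarrow> (\<forall>i\<in>{1..k}. prefix_rank p i = prefix_rank q i)"
proof
  assume eq: "prefix_flattening k p = prefix_flattening k q"
  show "\<forall>i\<in>{1..k}. prefix_rank p i = prefix_rank q i"
  proof
    fix i assume i: "i \<in> {1..k}"
    have "{l \<in> {1..i}. p l \<le> p i} = {l \<in> {1..i}. q l \<le> q i}"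
      using prefix_flattening_le_iff[of i k _ p] prefix_flattening_le_iff[of i k _ q] i
      by (auto simp: eq)
    then show "prefix_rank p i = prefix_rank q i" by (simp add: prefix_rank_def)
  qed
next
  assume "\<forall>i\<in>{1..k}. prefix_rank p i = prefix_rank q i"
  then have "p l \<le> p i \<longleftrightarrow> q l \<le> q i" if "i \<in> {1..k}" "l \<in> {1..k}" for i l
    using order_determined_by_prefix_ranks[OF assms] that by blast
  then have "{l \<in> {1..k}. p l \<le> p i} = {l \<in> {1..k}. q l \<le> q i}" if "i \<in> {1..k}" for i
    using that by blast
  then show "prefix_flattening k p = prefix_flattening k q"
    by (auto simp: prefix_flattening_def fun_eq_iff)
qed

lemma prefix_flattening_self:
  assumes "p permutes {1..n}"
  shows "prefix_flattening n p = p"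
proof
  fix i
  show "prefix_flattening n p i = p i"
  proof (cases "i \<in> {1..n}")
    case True
    then have "p i \<in> {1..n}" using permutes_in_image[OF assms] by blast
    then show ?thesis
      using card_low_positions[OF assms, of "p i"] True by (simp add: prefix_flattening_def)
  next
    case False
    then show ?thesis
      using permutes_not_in[OF assms False] by (simp only: prefix_flattening_def if_False)
  qed
qed

lemma card_codes: "card (codes n) = fact n"
  by (simp add: codes_def card_PiE fact_prod)

text \<open>Ranks determine the relative order and hence the permutation; surjectivity follows
  because both sets have \<open>fact n\<close> elements.\<close>

lemma bij_betw_rank_code:
  "bij_betw (\<lambda>p. restrict (prefix_rank p) {1..n}) {p. p permutes {1..n}} (codes n)"
  unfolding bij_betw_def
proof
  show inj: "inj_on (\<lambda>p. restrict (prefix_rank p) {1..n}) {p. p permutes {1..n}}"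
  proof (rule inj_onI, clarsimp)
    fix p q assume pq: "p permutes {Suc 0..n}" "q permutes {Suc 0..n}"
      and eq: "restrict (prefix_rank p) {Suc 0..n} = restrict (prefix_rank q) {Suc 0..n}"
    have "prefix_rank p i = prefix_rank q i" if "i \<in> {1..n}" for i
      using fun_cong[OF eq, of i] that by simp
    then have "prefix_flattening n p = prefix_flattening n q"
      using pq by (subst prefix_flattening_eq_iff) (auto intro: permutes_inj)
    then show "p = q" using pq prefix_flattening_self by simp
  qed
  show "(\<lambda>p. restrict (prefix_rank p) {1..n}) ` {p. p permutes {1..n}} = codes n"
  proof (rule card_subset_eq)
    show "finite (codes n)" by (simp add: codes_def finite_PiE)
    show "(\<lambda>p. restrict (prefix_rank p) {1..n}) ` {p. p permutes {1..n}} \<subseteq> codes n"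
      using prefix_rank_in_range by (auto simp: codes_def)
    show "card ((\<lambda>p. restrict (prefix_rank p) {1..n}) ` {p. p permutes {1..n}}) = card (codes n)"
      unfolding card_image[OF inj] by (simp add: card_codes card_permutations)
  qed
qed

text \<open>The left side says that the \<open>J - 1\<close> smallest values lie in the first
  \<open>I\<close> positions. Then each later position is preceded by all of them and has rank at
  least \<open>J\<close>. Conversely a rank never exceeds the value, so large ranks keep small
  values out of the later positions.\<close>

lemma le_J_stat_iff:
  assumes p: "p permutes {1..N}" and IN: "I < N" and J: "1 \<le> J" "J \<le> N"
  shows "J \<le> J_stat N I p \<longleftrightarrow> (\<forall>i\<in>{I + 1..N}. J \<le> prefix_rank p i)"
proof -
  obtain h where h: "J = Suc h" using J by (cases J) auto
  have rank_le: "prefix_rank p i \<le> p i" if "i \<in> {1..N}" for i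
  proof -
    have "p i \<in> {1..N}" using permutes_in_image[OF p] that by blast
    then have "card {l \<in> {1..N}. p l \<le> p i} = p i" using card_low_positions[OF p] by simp
    moreover have "prefix_rank p i \<le> card {l \<in> {1..N}. p l \<le> p i}"
      unfolding prefix_rank_def using that by (intro card_mono) auto
    ultimately show ?thesis by simp
  qed
  have "h < J_stat N I p \<longleftrightarrow> (\<forall>i\<in>{I + 1..N}. h < prefix_rank p i)"
  proof
    assume "h < J_stat N I p"
    then have low: "{i \<in> {1..N}. p i \<le> h} \<subseteq> {1..I}" using less_J_stat_iff[OF p IN] by blast
    show "\<forall>i\<in>{I + 1..N}. h < prefix_rank p i"
    proof
      fix i assume i: "i \<in> {I + 1..N}"
      then have "i \<notin> {i \<in> {1..N}. p i \<le> h}" using subsetD[OF low, of i] by auto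
      then have hi: "h < p i" using i by auto
      have "insert i {i \<in> {1..N}. p i \<le> h} \<subseteq> {l \<in> {1..i}. p l \<le> p i}"
        using low hi i by fastforce
      then have "card (insert i {i \<in> {1..N}. p i \<le> h}) \<le> prefix_rank p i"
        unfolding prefix_rank_def by (intro card_mono) auto
      then show "h < prefix_rank p i"
        using card_low_positions[OF p, of h] J h hi by simp
    qed
  next
    assume *: "\<forall>i\<in>{I + 1..N}. h < prefix_rank p i"
    have "i \<in> {1..I}" if "i \<in> {1..N}" "p i \<le> h" for i
    proof (rule ccontr)
      assume "i \<notin> {1..I}"
      then have "h < prefix_rank p i" using * that by auto
      then show False using rank_le[of i] that by simp
    qed
    then show "h < J_stat N I p" unfolding less_J_stat_iff[OF p IN] by blast
  qed
  then show ?thesis by (simp add: h Suc_le_eq)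
qed

section \<open>Winning as a signed count of records\<close>

definition later_records :: "nat \<Rightarrow> nat \<Rightarrow> (nat \<Rightarrow> nat) \<Rightarrow> nat" where
  "later_records N m r = card {i \<in> {m<..N}. r i = i}"

lemma eq_top_iff:
  assumes p: "p permutes {1..N}" and m: "m \<in> {1..N}"
  shows "p m = N \<longleftrightarrow> prefix_rank p m = m \<and> later_records N m (prefix_rank p) = 0"
proof -
  have le: "p l \<le> N" if "l \<in> {1..N}" for l
    using permutes_in_image[OF p, of l] that by simp
  have inj: "p i = p l \<longleftrightarrow> i = l" for i l
    using permutes_inj[OF p] by (simp add: inj_eq)
  have lr: "later_records N m (prefix_rank p) = 0 \<longleftrightarrow> (\<forall>i\<in>{m<..N}. prefix_rank p i \<noteq> i)"
    by (auto simp: later_records_def)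
  show ?thesis
    unfolding lr
  proof (intro iffI conjI ballI)
    assume top: "p m = N"
    then show "prefix_rank p m = m"
      using le m by (subst prefix_rank_eq_self_iff) auto
    fix i assume i: "i \<in> {m<..N}"
    show "prefix_rank p i \<noteq> i"
    proof
      assume "prefix_rank p i = i"
      then have "p m \<le> p i" using prefix_rank_eq_self_iff[of i p] i m by auto
      then have "p i = p m" using le[of i] i top m by simp
      then show False using inj i by auto
    qed
  next
    assume *: "prefix_rank p m = m \<and> (\<forall>i\<in>{m<..N}. prefix_rank p i \<noteq> i)"
    have "N \<in> p ` {1..N}" using permutes_image[OF p] m by auto
    then obtain M where M: "M \<in> {1..N}" "p M = N" by auto
    have "prefix_rank p M = M" using M le by (subst prefix_rank_eq_self_iff) auto
    then have "M \<le> m" using * M by (meson atLeastAtMost_iff greaterThanAtMost_iff not_le)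
    then have "p M \<le> p m" using * prefix_rank_eq_self_iff[of m p] m M by auto
    then show "p m = N" using M le[OF m] by simp
  qed
qed

text \<open>On records this is 1 at the last one, -1 at the penultimate one and 0 at all earlier
  ones.\<close>

definition tail_sign :: "nat \<Rightarrow> nat \<Rightarrow> (nat \<Rightarrow> nat) \<Rightarrow> real" where
  "tail_sign N m r = of_bool (later_records N m r = 0) - of_bool (later_records N m r = 1)"

text \<open>If \<open>t\<close> is the last record, only it contributes. Otherwise the penultimate
  record is also at least \<open>t\<close> and cancels the last one.\<close>

lemma sum_tail_sign:
  assumes t: "t \<in> {1..N}" "r t = t"
  shows "(\<Sum>m | m \<in> {1..N} \<and> r m = m \<and> t \<le> m. tail_sign N m r) = of_bool (later_records N t r = 0)"
proof -
  define S where "S = {m \<in> {1..N}. r m = m}"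
  have S: "finite S" "t \<in> S" using t by (auto simp: S_def)
  define M where "M = Max S"
  have M: "M \<in> S" "\<And>m. m \<in> S \<Longrightarrow> m \<le> M"
    unfolding M_def using S by (auto intro!: Max_in)
  have later: "{i \<in> {m<..N}. r i = i} = {i \<in> S. m < i}" if "m \<in> S" for m
    by (auto simp: S_def)
  have zero: "later_records N m r = 0 \<longleftrightarrow> m = M" if "m \<in> S" for m
  proof -
    have "later_records N m r = 0 \<longleftrightarrow> {i \<in> S. m < i} = {}"
      unfolding later_records_def later[OF that] using S(1) by simp
    also have "\<dots> \<longleftrightarrow> m = M"
      using M(1) M(2) that by (metis (mono_tags, lifting) empty_Collect_eq leD le_neq_implies_less)
    finally show ?thesis .
  qed
  have index: "{m. m \<in> {1..N} \<and> r m = m \<and> t \<le> m} = {m \<in> S. t \<le> m}" by (auto simp: S_def)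
  show ?thesis
  proof (cases "t = M")
    case True
    then have "{m \<in> S. t \<le> m} = {M}" using M by (auto intro: le_antisym)
    then show ?thesis using zero[OF M(1)] True unfolding index by (simp add: tail_sign_def)
  next
    case False
    define M' where "M' = Max (S - {M})"
    have tM: "t \<in> S - {M}" using False S by simp
    then have "M' \<in> S - {M}" unfolding M'_def using S(1) by (intro Max_in) auto
    moreover have le': "m \<le> M'" if "m \<in> S - {M}" for m
      unfolding M'_def using S(1) that by (intro Max_ge) auto
    ultimately have M': "M' \<in> S" "M' < M" "t \<le> M'" using M tM by (auto simp: order.strict_iff_order)
    have one: "later_records N m r = 1 \<longleftrightarrow> m = M'" if mS: "m \<in> S" for m
    proof
      assume "m = M'"
      moreover have "{i \<in> S. M' < i} = {M}" using M' M le' by (auto simp: not_less[symmetric])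
      ultimately show "later_records N m r = 1" unfolding later_records_def later[OF mS] by simp
    next
      assume *: "later_records N m r = 1"
      then obtain c where c: "{i \<in> S. m < i} = {c}"
        unfolding later_records_def later[OF mS] by (auto simp: card_1_singleton_iff)
      have "m \<noteq> M" using * zero[OF mS] by auto
      then have "m < M" using M(2)[OF mS] by simp
      then have "M \<in> {i \<in> S. m < i}" using M(1) by simp
      then have "M' \<notin> {i \<in> S. m < i}" unfolding c using M'(2) by simp
      then have "\<not> m < M'" using M'(1) by simp
      then show "m = M'" using le'[of m] mS \<open>m \<noteq> M\<close> by simp
    qed
    have "(\<Sum>m | m \<in> S \<and> t \<le> m. tail_sign N m r)
        = (\<Sum>m | m \<in> S \<and> t \<le> m. (if m = M then 1 else 0) - (if m = M' then 1 else 0))"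
      by (intro sum.cong) (use M'(2) in \<open>auto simp: tail_sign_def zero one[simplified]\<close>)
    also have "\<dots> = 0"
      using M M' S tM by (simp add: sum_subtractf)
    finally show ?thesis using zero[OF S(2)] False unfolding index by simp
  qed
qed

text \<open>A stop at a position that is not a record loses for certain; demanding a record at the
  stopping position makes such runs contribute nothing.\<close>

definition record_stop :: "nat \<Rightarrow> strategy \<Rightarrow> nat \<Rightarrow> (nat \<Rightarrow> nat) \<Rightarrow> bool" where
  "record_stop N A m p \<longleftrightarrow>
     prefix_rank p (stop_position N A p) = stop_position N A p \<and> stop_position N A p \<le> m"

lemma stop_position:
  assumes "1 \<le> N"
  shows "stop_position N A p \<in> {1..N}"
    and "A (stop_position N A p) (prefix_flattening (stop_position N A p) p) \<or> stop_position N A p = N"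
    and "1 \<le> k \<Longrightarrow> A k (prefix_flattening k p) \<or> k = N \<Longrightarrow> stop_position N A p \<le> k"
proof -
  let ?P = "\<lambda>k. 1 \<le> k \<and> (A k (prefix_flattening k p) \<or> k = N)"
  have "?P N" using assms by simp
  then have "?P (stop_position N A p)" "stop_position N A p \<le> N"
    unfolding stop_position_def by (rule LeastI, rule Least_le)
  then show "stop_position N A p \<in> {1..N}"
    "A (stop_position N A p) (prefix_flattening (stop_position N A p) p) \<or> stop_position N A p = N"
    by auto
  show "1 \<le> k \<Longrightarrow> A k (prefix_flattening k p) \<or> k = N \<Longrightarrow> stop_position N A p \<le> k"
    unfolding stop_position_def by (intro Least_le) simp
qed

text \<open>If the stopping position is a record, \<open>sum_tail_sign\<close> applies with it as
  \<open>t\<close>; if not, both sides are 0.\<close>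

lemma of_bool_wins:
  assumes p: "p permutes {1..N}" and N: "1 \<le> N"
  shows "(of_bool (wins N A p) :: real)
       = (\<Sum>m = 1..N. of_bool (prefix_rank p m = m \<and> record_stop N A m p) * tail_sign N m (prefix_rank p))"
proof -
  let ?T = "stop_position N A p"
  have T: "?T \<in> {1..N}" using stop_position(1)[OF N] .
  have wins: "wins N A p \<longleftrightarrow> prefix_rank p ?T = ?T \<and> later_records N ?T (prefix_rank p) = 0"
    unfolding wins_def using eq_top_iff[OF p T] .
  show ?thesis
  proof (cases "prefix_rank p ?T = ?T")
    case True
    have "(\<Sum>m = 1..N. of_bool (prefix_rank p m = m \<and> record_stop N A m p) * tail_sign N m (prefix_rank p))
       = (\<Sum>m = 1..N. if prefix_rank p m = m \<and> ?T \<le> m then tail_sign N m (prefix_rank p) else 0)"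
      using True by (intro sum.cong) (auto simp: record_stop_def)
    also have "\<dots> = (\<Sum>m | m \<in> {1..N} \<and> prefix_rank p m = m \<and> ?T \<le> m. tail_sign N m (prefix_rank p))"
      by (rule sum.inter_filter[symmetric]) simp
    also have "\<dots> = of_bool (wins N A p)"
      using sum_tail_sign[of ?T N "prefix_rank p"] T wins True by simp
    finally show ?thesis by simp
  qed (simp add: wins record_stop_def)
qed

text \<open>Up to time \<open>m\<close> both runs show the same flattenings, so a stop by then
  occurs in both at the same position. This makes being stopped a property of the prefix.\<close>

lemma record_stop_cong:
  assumes inj: "inj p" "inj q" and N: "1 \<le> N"
    and eq: "\<And>i. i \<in> {1..m} \<Longrightarrow> prefix_rank p i = prefix_rank q i"
    and stop: "record_stop N A m p"
  shows "record_stop N A m q"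
proof -
  let ?T = "stop_position N A p"
  have T: "?T \<in> {1..N}" "?T \<le> m" "prefix_rank p ?T = ?T"
    using stop stop_position(1)[OF N] by (auto simp: record_stop_def)
  have flat: "prefix_flattening k p = prefix_flattening k q" if "k \<le> m" for k
    using eq that inj by (subst prefix_flattening_eq_iff) auto
  have "stop_position N A q = ?T"
    unfolding stop_position_def[of N A q]
  proof (rule Least_equality)
    show "1 \<le> ?T \<and> (A ?T (prefix_flattening ?T q) \<or> ?T = N)"
      using stop_position(2)[OF N, of A p] T flat[of ?T] by auto
    fix k assume k: "1 \<le> k \<and> (A k (prefix_flattening k q) \<or> k = N)"
    show "?T \<le> k"
    proof (cases "k \<le> m")
      case True
      then show ?thesis using k flat[of k] stop_position(3)[OF N, of k A p] by auto
    qed (use T in simp)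
  qed
  then show ?thesis using T eq[of ?T] by (simp add: record_stop_def)
qed

subsection \<open>Counting continuations of a prefix\<close>

lemma prod_diff_fact:
  assumes "c \<le> a" "a \<le> b"
  shows "(\<Prod>i = a + 1..b. real (i - c)) = fact (b - c) / fact (a - c)"
  using assms(2)
proof (induction rule: dec_induct)
  case (step n)
  then have "{a + 1..Suc n} = insert (Suc n) {a + 1..n}" by auto
  then have "(\<Prod>i = a + 1..Suc n. real (i - c)) = real (Suc n - c) * (\<Prod>i = a + 1..n. real (i - c))"
    by simp
  also have "\<dots> = real (Suc n - c) * fact (n - c) / fact (a - c)"
    using step.IH by simp
  also have "real (Suc n - c) * fact (n - c) = fact (Suc n - c)"
    using step assms(1) by (simp add: Suc_diff_le)
  finally show ?case .
qed simp

lemma sum_prod_remove: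
  fixes f :: "nat \<Rightarrow> real"
  assumes "finite A" "\<And>i. i \<in> A \<Longrightarrow> f i \<noteq> 0"
  shows "(\<Sum>c\<in>A. \<Prod>i\<in>A - {c}. f i) = (\<Prod>i\<in>A. f i) * (\<Sum>c\<in>A. 1 / f c)"
  unfolding sum_distrib_left
  by (intro sum.cong refl) (use assms in \<open>simp add: prod.remove[of A _ f]\<close>)

text \<open>The least admissible rank in position \<open>i\<close> when the values \<open>1, \<dots>, J - 1\<close> must occupy
  positions at most \<open>I\<close>.\<close>

definition least_rank :: "nat \<Rightarrow> nat \<Rightarrow> nat \<Rightarrow> nat" where
  "least_rank I J i = (if I < i then J else 1)"

text \<open>Each factor \<open>i - least_rank I J i\<close> counts the admissible ranks at
  \<open>i\<close> that do not create a record, so the product counts continuations without a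
  further record.\<close>

lemma sigma_dot_eq_prod:
  assumes "1 \<le> m" "m \<le> N" "1 \<le> I" "I < N" "1 \<le> J" "J \<le> I + 1"
  shows "sigma_dot N I m J = real (N choose (J - 1)) * (\<Prod>i = m + 1..N. real (i - least_rank I J i))"
proof (cases "I < m")
  case True
  have "(\<Prod>i = m + 1..N. real (i - least_rank I J i)) = (\<Prod>i = m + 1..N. real (i - J))"
    using True by (intro prod.cong) (auto simp: least_rank_def)
  then show ?thesis
    using True assms prod_diff_fact[of J m N] by (simp add: sigma_dot_def)
next
  case False
  have split: "{m + 1..N} = {m + 1..I} \<union> {I + 1..N}" using False assms by auto
  have "(\<Prod>i = m + 1..N. real (i - least_rank I J i))
      = (\<Prod>i = m + 1..I. real (i - least_rank I J i)) * (\<Prod>i = I + 1..N. real (i - least_rank I J i))"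
    unfolding split by (intro prod.union_disjoint) auto
  also have "(\<Prod>i = m + 1..I. real (i - least_rank I J i)) = (\<Prod>i = m + 1..I. real (i - 1))"
    by (intro prod.cong) (auto simp: least_rank_def)
  also have "\<dots> = fact (I - 1) / fact (m - 1)"
    using False assms by (intro prod_diff_fact) auto
  also have "(\<Prod>i = I + 1..N. real (i - least_rank I J i)) = (\<Prod>i = I + 1..N. real (i - J))"
    by (intro prod.cong) (auto simp: least_rank_def)
  \<comment> \<open>For \<open>J = I + 1\<close> the rank in position \<open>I + 1\<close> is forced
    to be \<open>I + 1\<close>; a record there is unavoidable and the corresponding factor is
    0.\<close>
  also have "\<dots> = (if J \<le> I then fact (N - J) / fact (I - J) else 0)"
    using assms prod_diff_fact[of J I N] by (cases "J \<le> I") (auto intro!: bexI[of _ "I + 1"])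
  finally show ?thesis using False by (simp add: sigma_dot_def mult_ac)
qed

lemma tau_dot_low:
  assumes "1 \<le> I" "m \<le> I"
  shows "tau_dot N I m J = fact (I - 1) / fact (m - 1) * tau_dot_I N I J
    + sigma_dot N I m J * (\<Sum>i = m..I - 1. 1 / real i)"
  using assms by (auto simp: tau_dot_def)

text \<open>Here \<open>c\<close> is the position of the only further record. Its rank is forced, so
  its factor is omitted from the product.\<close>

lemma tau_dot_eq_sum_prod:
  assumes "1 \<le> m" "m \<le> N" "1 \<le> I" "I < N" "1 \<le> J" "J \<le> I + 1"
  shows "tau_dot N I m J = real (N choose (J - 1)) *
    (\<Sum>c = m + 1..N. \<Prod>i\<in>{m + 1..N} - {c}. real (i - least_rank I J i))"
proof -
  let ?f = "\<lambda>i. real (i - least_rank I J i)"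
  have harm: "(\<Sum>c = k + 1..N. 1 / real (c - J)) = (\<Sum>i = k - J + 1..N - J. 1 / real i)"
    if "J \<le> k" for k
    by (rule sum.reindex_bij_witness[of _ "\<lambda>i. i + J" "\<lambda>c. c - J"]) (use that in auto)
  consider "I < m" | "m \<le> I" "J \<le> I" | "m \<le> I" "J = I + 1" using assms by linarith
  then show ?thesis
  proof cases
    case 1
    have "(\<Sum>c = m + 1..N. \<Prod>i\<in>{m + 1..N} - {c}. ?f i)
        = (\<Prod>i = m + 1..N. ?f i) * (\<Sum>c = m + 1..N. 1 / ?f c)"
      using 1 assms by (intro sum_prod_remove) (auto simp: least_rank_def)
    also have "(\<Sum>c = m + 1..N. 1 / ?f c) = (\<Sum>c = m + 1..N. 1 / real (c - J))"
      using 1 by (intro sum.cong) (auto simp: least_rank_def)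
    also have "\<dots> = (\<Sum>i = m - J + 1..N - J. 1 / real i)"
      using 1 assms by (intro harm) auto
    finally show ?thesis
      using 1 sigma_dot_eq_prod[OF assms] by (simp add: tau_dot_def)
  next
    case 2
    have "(\<Sum>c = m + 1..N. \<Prod>i\<in>{m + 1..N} - {c}. ?f i)
        = (\<Prod>i = m + 1..N. ?f i) * (\<Sum>c = m + 1..N. 1 / ?f c)"
      using 2 assms by (intro sum_prod_remove) (auto simp: least_rank_def)
    also have "(\<Sum>c = m + 1..N. 1 / ?f c) = (\<Sum>c = m + 1..I. 1 / ?f c) + (\<Sum>c = I + 1..N. 1 / ?f c)"
    proof -
      have "{m + 1..N} = {m + 1..I} \<union> {I + 1..N}" using 2 assms by auto
      then show ?thesis by (simp only:) (intro sum.union_disjoint; auto)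
    qed
    also have "(\<Sum>c = m + 1..I. 1 / ?f c) = (\<Sum>i = m..I - 1. 1 / real i)"
      by (rule sum.reindex_bij_witness[of _ "\<lambda>i. i + 1" "\<lambda>c. c - 1"]) (use 2 assms in \<open>auto simp: least_rank_def\<close>)
    also have "(\<Sum>c = I + 1..N. 1 / ?f c) = (\<Sum>c = I + 1..N. 1 / real (c - J))"
      by (intro sum.cong) (auto simp: least_rank_def)
    also have "\<dots> = (\<Sum>i = I - J + 1..N - J. 1 / real i)"
      using 2 by (intro harm) auto
    finally have "real (N choose (J - 1)) * (\<Sum>c = m + 1..N. \<Prod>i\<in>{m + 1..N} - {c}. ?f i)
        = sigma_dot N I m J * ((\<Sum>i = m..I - 1. 1 / real i) + (\<Sum>i = I - J + 1..N - J. 1 / real i))"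
      using sigma_dot_eq_prod[OF assms] by simp
    moreover have "fact (I - 1) / fact (m - 1) * tau_dot_I N I J
        = sigma_dot N I m J * (\<Sum>i = I - J + 1..N - J. 1 / real i)"
      using 2 by (simp add: sigma_dot_def tau_dot_I_def)
    ultimately show ?thesis
      using tau_dot_low[OF assms(3) 2(1), of N J] by (simp only: distrib_left add.commute)
  next
    case 3
    \<comment> \<open>The factor at \<open>I + 1\<close> vanishes, so dividing the full product by
      single factors is impossible. Only the summand that omits this factor, with
      \<open>c = I + 1\<close>, survives.\<close>
    have zero: "(\<Prod>i\<in>{m + 1..N} - {c}. ?f i) = 0" if "c \<in> {m + 1..N}" "c \<noteq> I + 1" for c
      using that 3 assms by (intro prod_zero) (auto intro!: bexI[of _ "I + 1"] simp: least_rank_def)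
    have "(\<Sum>c = m + 1..N. \<Prod>i\<in>{m + 1..N} - {c}. ?f i)
        = (\<Sum>c = m + 1..N. if c = I + 1 then \<Prod>i\<in>{m + 1..N} - {I + 1}. ?f i else 0)"
      by (intro sum.cong refl) (use zero in auto)
    also have "\<dots> = (\<Prod>i\<in>{m + 1..N} - {I + 1}. ?f i)"
      using 3 assms by (subst sum.delta) auto
    also have "\<dots> = (\<Prod>i = m + 1..I. ?f i) * (\<Prod>i = I + 1 + 1..N. ?f i)"
    proof -
      have "{m + 1..N} - {I + 1} = {m + 1..I} \<union> {I + 1 + 1..N}" using 3 assms by auto
      then show ?thesis by (simp only:) (intro prod.union_disjoint; auto)
    qed
    also have "(\<Prod>i = m + 1..I. ?f i) = (\<Prod>i = m + 1..I. real (i - 1))"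
      by (intro prod.cong) (auto simp: least_rank_def)
    also have "\<dots> = fact (I - 1) / fact (m - 1)"
      using 3 assms by (intro prod_diff_fact) auto
    also have "(\<Prod>i = I + 1 + 1..N. ?f i) = (\<Prod>i = I + 1 + 1..N. real (i - J))"
      by (intro prod.cong) (auto simp: least_rank_def)
    also have "\<dots> = fact (N - J) / fact (I + 1 - J)"
      using 3 assms by (intro prod_diff_fact) auto
    finally have *: "(\<Sum>c = m + 1..N. \<Prod>i\<in>{m + 1..N} - {c}. ?f i)
      = fact (I - 1) / fact (m - 1) * fact (N - (I + 1))" using 3 by simp
    have "real (N choose I) = fact N / (fact I * fact (N - I))"
      using assms by (simp add: binomial_fact)
    moreover have "fact (N - I) = real (N - I) * fact (N - (I + 1))"
      using assms fact_reduce[of "N - I", where 'a=real] by simp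
    ultimately have "real (N choose I) * fact (N - (I + 1)) = fact N / (fact I * real (N - I))"
      using assms by simp
    then have "tau_dot_I N I J = real (N choose I) * fact (N - (I + 1))"
      using 3 by (simp add: tau_dot_I_def)
    then show ?thesis
      unfolding * using tau_dot_low[OF assms(3) 3(1)] 3 by (simp add: sigma_dot_def)
  qed
qed

lemma card_PiE_split:
  fixes m N :: nat
  assumes "m \<le> N"
  shows "card (\<Pi>\<^sub>E i\<in>{1..N}. if i \<le> m then {s i} else Q i) = (\<Prod>i = m + 1..N. card (Q i))"
proof -
  have "{1..N} = {1..m} \<union> {m + 1..N}" using assms by auto
  then have "(\<Prod>i = 1..N. card (if i \<le> m then {s i} else Q i))
      = (\<Prod>i = 1..m. card (if i \<le> m then {s i} else Q i))
      * (\<Prod>i = m + 1..N. card (if i \<le> m then {s i} else Q i))"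
    by (simp only:) (intro prod.union_disjoint; auto)
  also have "\<dots> = (\<Prod>i = m + 1..N. card (Q i))" by simp
  finally show ?thesis by (simp add: card_PiE)
qed

lemma mem_PiE_split_iff:
  fixes m N :: nat
  assumes "m \<le> N"
  shows "r \<in> (\<Pi>\<^sub>E i\<in>{1..N}. if i \<le> m then {s i} else Q i) \<longleftrightarrow>
    r \<in> extensional {1..N} \<and> (\<forall>i\<in>{1..m}. r i = s i) \<and> (\<forall>i\<in>{m<..N}. r i \<in> Q i)"
    (is "r \<in> ?P \<longleftrightarrow> ?R")
proof
  assume r: "r \<in> ?P"
  have "r i = s i" if "i \<in> {1..m}" for i
    using PiE_mem[OF r, of i] that assms by simp
  moreover have "r i \<in> Q i" if "i \<in> {m<..N}" for i
    using PiE_mem[OF r, of i] that by simp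
  ultimately show ?R using r by (simp add: PiE_iff)
next
  assume ?R
  then show "r \<in> ?P" by (auto simp: PiE_iff)
qed

text \<open>By \<open>le_J_stat_iff\<close> the last condition says that the coded permutation has
  J-statistic at least \<open>J\<close>.\<close>

definition extensions :: "nat \<Rightarrow> nat \<Rightarrow> nat \<Rightarrow> nat \<Rightarrow> (nat \<Rightarrow> nat) \<Rightarrow> (nat \<Rightarrow> nat) set" where
  "extensions N I J m s =
     {r \<in> codes N. restrict r {1..m} = s \<and> (\<forall>i\<in>{I + 1..N}. J \<le> r i)}"

context
  fixes N I J m :: nat and s :: "nat \<Rightarrow> nat"
  assumes m: "1 \<le> m" "m \<le> N" and I: "1 \<le> I" "I < N" and J: "1 \<le> J" "J \<le> I + 1"
    and s: "s \<in> codes m" and ok: "\<And>i. i \<in> {I + 1..m} \<Longrightarrow> J \<le> s i"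
begin

text \<open>Ranks in different positions are chosen independently, so the set is a product of
  intervals and its cardinalities become products.\<close>

lemma mem_extensions_iff:
  "r \<in> extensions N I J m s \<longleftrightarrow> r \<in> (\<Pi>\<^sub>E i\<in>{1..N}. if i \<le> m then {s i} else {least_rank I J i..i})"
proof
  assume r: "r \<in> extensions N I J m s"
  then have "r i = s i" if "i \<in> {1..m}" for i
    using that by (auto simp: extensions_def)
  then show "r \<in> (\<Pi>\<^sub>E i\<in>{1..N}. if i \<le> m then {s i} else {least_rank I J i..i})"
    using r by (auto simp: extensions_def codes_def PiE_iff least_rank_def)
next
  assume r: "r \<in> (\<Pi>\<^sub>E i\<in>{1..N}. if i \<le> m then {s i} else {least_rank I J i..i})"
  then have low: "r i = s i" if "i \<in> {1..m}" for i
    using PiE_mem[OF r, of i] that m by (simp split: if_splits)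
  have high: "r i \<in> {least_rank I J i..i}" if "i \<in> {m + 1..N}" for i
    using PiE_mem[OF r, of i] that by (simp split: if_splits)
  have "restrict r {1..m} = s"
  proof (rule PiE_ext)
    show "restrict r {1..m} \<in> (\<Pi>\<^sub>E i\<in>{1..m}. {s i})" using low by auto
    show "s \<in> (\<Pi>\<^sub>E i\<in>{1..m}. {s i})" using s by (auto simp: codes_def PiE_iff)
  qed (use low in auto)
  moreover have "r i \<in> {1..i}" if "i \<in> {1..N}" for i
  proof (cases "i \<le> m")
    case True
    then show ?thesis using low[of i] s that by (auto simp: codes_def PiE_iff)
  next
    case False
    then show ?thesis using high[of i] that J by (auto simp: least_rank_def split: if_splits)
  qed
  moreover have "J \<le> r i" if "i \<in> {I + 1..N}" for i
  proof (cases "i \<le> m")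
    case True
    then show ?thesis using low[of i] ok[of i] that by auto
  next
    case False
    then show ?thesis using high[of i] that by (auto simp: least_rank_def split: if_splits)
  qed
  ultimately show "r \<in> extensions N I J m s"
    using r by (auto simp: extensions_def codes_def PiE_iff)
qed

lemma card_extensions_no_record:
  "card {r \<in> extensions N I J m s. later_records N m r = 0} = (\<Prod>i = m + 1..N. i - least_rank I J i)"
proof -
  have "r \<in> extensions N I J m s \<and> later_records N m r = 0 \<longleftrightarrow>
      r \<in> (\<Pi>\<^sub>E i\<in>{1..N}. if i \<le> m then {s i} else {least_rank I J i..<i})" for r
  proof -
    have "later_records N m r = 0 \<longleftrightarrow> (\<forall>i\<in>{m<..N}. r i \<noteq> i)"
      by (auto simp: later_records_def)
    moreover have "r i \<in> {least_rank I J i..<i} \<longleftrightarrow> r i \<in> {least_rank I J i..i} \<and> r i \<noteq> i" for i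
      by auto
    ultimately show ?thesis
      unfolding mem_extensions_iff mem_PiE_split_iff[OF m(2)] by blast
  qed
  then have "{r \<in> extensions N I J m s. later_records N m r = 0}
      = (\<Pi>\<^sub>E i\<in>{1..N}. if i \<le> m then {s i} else {least_rank I J i..<i})"
    by blast
  then show ?thesis by (simp only: card_PiE_split[OF m(2)] card_atLeastLessThan)
qed

text \<open>Split by the position \<open>c\<close> of the single later record; for fixed
  \<open>c\<close> the set is again a product.\<close>

lemma card_extensions_one_record:
  "card {r \<in> extensions N I J m s. later_records N m r = 1}
     = (\<Sum>c = m + 1..N. \<Prod>i\<in>{m + 1..N} - {c}. i - least_rank I J i)"
proof -
  define X where "X = (\<lambda>c. \<Pi>\<^sub>E i\<in>{1..N}. if i \<le> m then {s i}
      else if i = c then {i} else {least_rank I J i..<i})"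
  have memX: "r \<in> X c \<longleftrightarrow> r \<in> extensions N I J m s \<and> {i \<in> {m<..N}. r i = i} = {c}" if c: "c \<in> {m + 1..N}" for r c
  proof -
    have pt: "r i \<in> (if i = c then {i} else {least_rank I J i..<i}) \<longleftrightarrow>
        r i \<in> {least_rank I J i..i} \<and> (r i = i \<longleftrightarrow> i = c)" if "i \<in> {m<..N}" for i
    proof -
      have "least_rank I J i \<le> i" using that J m by (auto simp: least_rank_def)
      then show ?thesis by auto
    qed
    have all: "(\<forall>i\<in>{m<..N}. r i \<in> (if i = c then {i} else {least_rank I J i..<i})) \<longleftrightarrow>
        (\<forall>i\<in>{m<..N}. r i \<in> {least_rank I J i..i}) \<and> (\<forall>i\<in>{m<..N}. r i = i \<longleftrightarrow> i = c)"
      by (simp only: pt ball_conj_distrib cong: ball_cong)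
    have single: "{i \<in> {m<..N}. r i = i} = {c} \<longleftrightarrow> (\<forall>i\<in>{m<..N}. r i = i \<longleftrightarrow> i = c)"
    proof -
      have "c \<in> {m<..N}" using c by simp
      then show ?thesis by blast
    qed
    show ?thesis
      unfolding mem_extensions_iff X_def mem_PiE_split_iff[OF m(2)] all single by (simp only: conj_assoc)
  qed
  have "{r \<in> extensions N I J m s. later_records N m r = 1} = (\<Union>c\<in>{m + 1..N}. X c)"
  proof (intro set_eqI iffI)
    fix r assume r: "r \<in> {r \<in> extensions N I J m s. later_records N m r = 1}"
    then obtain c where c: "{i \<in> {m<..N}. r i = i} = {c}"
      unfolding later_records_def One_nat_def by (auto simp only: card_1_singleton_iff)
    then have "c \<in> {m<..N}" by blast
    then have "c \<in> {m + 1..N}" by simp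
    with c show "r \<in> (\<Union>c\<in>{m + 1..N}. X c)" using r memX by blast
  next
    fix r assume "r \<in> (\<Union>c\<in>{m + 1..N}. X c)"
    then show "r \<in> {r \<in> extensions N I J m s. later_records N m r = 1}"
      using memX by (auto simp only: later_records_def One_nat_def card_1_singleton_iff)
  qed
  also have "card \<dots> = (\<Sum>c = m + 1..N. card (X c))"
  proof (rule card_UN_disjoint)
    show "\<forall>c\<in>{m + 1..N}. finite (X c)" by (auto simp: X_def intro!: finite_PiE)
    show "\<forall>c\<in>{m + 1..N}. \<forall>d\<in>{m + 1..N}. c \<noteq> d \<longrightarrow> X c \<inter> X d = {}"
      using memX by blast
  qed simp
  also have "\<dots> = (\<Sum>c = m + 1..N. \<Prod>i\<in>{m + 1..N} - {c}. i - least_rank I J i)"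
  proof (rule sum.cong[OF refl])
    fix c assume c: "c \<in> {m + 1..N}"
    have "card (X c) = (\<Prod>i = m + 1..N. card (if i = c then {i} else {least_rank I J i..<i}))"
      unfolding X_def using m by (intro card_PiE_split) auto
    also have "\<dots> = (\<Prod>i\<in>{m + 1..N} - {c}. i - least_rank I J i)"
      using c by (simp add: prod.remove[of _ c] del: prod.cl_ivl_Suc)
    finally show "card (X c) = (\<Prod>i\<in>{m + 1..N} - {c}. i - least_rank I J i)" .
  qed
  finally show ?thesis .
qed

end

text \<open>For \<open>k \<le> I\<close> the value is arbitrary, since \<^const>\<open>Delta_dot\<close> then ignores it.\<close>

definition code_J :: "nat \<Rightarrow> nat \<Rightarrow> (nat \<Rightarrow> nat) \<Rightarrow> nat" where
  "code_J I k s = (if I < k then Min (s ` {I + 1..k}) else 1)"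

text \<open>The left side is the case condition in \<open>Delta_dot\<close>; for
  \<open>k \<le> I\<close> the range on the right is empty.\<close>

lemma le_code_J_iff: "k \<le> I \<or> J \<le> code_J I k s \<longleftrightarrow> (\<forall>i\<in>{I + 1..k}. J \<le> s i)"
  by (cases "I < k") (auto simp: code_J_def)

lemma code_J_mono:
  assumes "I < k" "k \<le> k'"
  shows "code_J I k' s \<le> code_J I k s"
  using assms by (auto simp: code_J_def intro!: Min_antimono)

lemma code_J_range:
  assumes "\<And>i. i \<in> {1..k} \<Longrightarrow> s i \<in> {1..i}"
  shows "code_J I k s \<in> {1..I + 1}"
proof (cases "I < k")
  case True
  then have "Min (s ` {I + 1..k}) \<le> s (I + 1)" by (intro Min_le) auto
  also have "\<dots> \<le> I + 1" using assms[of "I + 1"] True by simp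
  finally have "code_J I k s \<le> I + 1" using True by (simp add: code_J_def)
  moreover have "1 \<le> code_J I k s"
    using True assms le_code_J_iff[of k I 1 s] by auto
  ultimately show ?thesis by simp
qed (simp add: code_J_def)

lemma code_J_cong: "(\<And>i. i \<in> {1..k} \<Longrightarrow> r i = s i) \<Longrightarrow> code_J I k r = code_J I k s"
  unfolding code_J_def by (auto intro!: arg_cong[of _ _ Min] image_cong)

lemma codes_range: "s \<in> codes n \<Longrightarrow> i \<in> {1..n} \<Longrightarrow> s i \<in> {1..i}"
  unfolding codes_def by (rule PiE_mem)

lemma finite_codes: "finite (codes n)"
  by (simp add: codes_def finite_PiE)

text \<open>The two parts of \<open>tail_sign\<close> count continuations with no later record and
  with exactly one, giving \<open>sigma_dot\<close> and \<open>tau_dot\<close>. A prefix that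
  already violates the bound \<open>J\<close> has no extensions, which matches the value 0 of
  \<open>Delta_dot\<close>.\<close>

lemma sum_tail_sign_extensions:
  assumes m: "1 \<le> m" "m \<le> N" and I: "1 \<le> I" "I < N" and J: "1 \<le> J" "J \<le> I + 1"
    and s: "s \<in> codes m"
  shows "real (N choose (J - 1)) *
    (\<Sum>r | r \<in> codes N \<and> restrict r {1..m} = s. of_bool (\<forall>i\<in>{I + 1..N}. J \<le> r i) * tail_sign N m r)
    = Delta_dot N I m (code_J I m s) J"
proof -
  have "(\<Sum>r | r \<in> codes N \<and> restrict r {1..m} = s. of_bool (\<forall>i\<in>{I + 1..N}. J \<le> r i) * tail_sign N m r)
      = (\<Sum>r | r \<in> codes N \<and> restrict r {1..m} = s. if \<forall>i\<in>{I + 1..N}. J \<le> r i then tail_sign N m r else 0)"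
    by (intro sum.cong refl) simp
  also have "\<dots> = (\<Sum>r | r \<in> {r. r \<in> codes N \<and> restrict r {1..m} = s} \<and> (\<forall>i\<in>{I + 1..N}. J \<le> r i). tail_sign N m r)"
    using finite_codes by (intro sum.inter_filter[symmetric]) simp
  also have "\<dots> = (\<Sum>r\<in>extensions N I J m s. tail_sign N m r)"
    by (intro sum.cong) (auto simp: extensions_def)
  finally have eq: "(\<Sum>r | r \<in> codes N \<and> restrict r {1..m} = s.
      of_bool (\<forall>i\<in>{I + 1..N}. J \<le> r i) * tail_sign N m r) = (\<Sum>r\<in>extensions N I J m s. tail_sign N m r)" .
  show ?thesis
  proof (cases "\<forall>i\<in>{I + 1..m}. J \<le> s i")
    case True
    then have ok: "\<And>i. i \<in> {I + 1..m} \<Longrightarrow> J \<le> s i" by blast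
    have fin: "finite (extensions N I J m s)" using finite_codes by (simp add: extensions_def)
    have "(\<Sum>r\<in>extensions N I J m s. tail_sign N m r)
        = real (card {r \<in> extensions N I J m s. later_records N m r = 0})
        - real (card {r \<in> extensions N I J m s. later_records N m r = 1})"
      using fin by (simp add: tail_sign_def sum_subtractf of_bool_def sum.inter_filter[symmetric])
    moreover have "m \<le> I \<or> J \<le> code_J I m s"
      using True le_code_J_iff by blast
    ultimately show ?thesis
      by (simp only: eq card_extensions_no_record[OF m I J s ok] card_extensions_one_record[OF m I J s ok]
          Delta_dot_def sigma_dot_eq_prod[OF m I J] tau_dot_eq_sum_prod[OF m I J]
          of_nat_sum of_nat_prod right_diff_distrib if_True)
  next
    case False
    have "extensions N I J m s = {}"
    proof (rule ccontr)
      assume "extensions N I J m s \<noteq> {}"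
      then obtain r where r: "restrict r {1..m} = s" "\<forall>i\<in>{I + 1..N}. J \<le> r i"
        by (auto simp: extensions_def)
      have "J \<le> s i" if "i \<in> {I + 1..m}" for i
      proof -
        have "s i = r i" unfolding r(1)[symmetric] using that by simp
        then show ?thesis using bspec[OF r(2), of i] that m by simp
      qed
      then show False using False by blast
    qed
    moreover have "\<not> (m \<le> I \<or> J \<le> code_J I m s)"
      using False le_code_J_iff by blast
    ultimately show ?thesis
      unfolding eq by (simp only: Delta_dot_def if_False sum.empty mult_zero_right)
  qed
qed

section \<open>The winning probability as a sum over stopped prefixes\<close>

definition code_weight :: "nat \<Rightarrow> nat \<Rightarrow> real \<Rightarrow> (nat \<Rightarrow> nat) \<Rightarrow> real" where
  "code_weight N I x r = (\<Sum>J = 1..I + 1.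
     of_bool (\<forall>i\<in>{I + 1..N}. J \<le> r i) * (real (N choose (J - 1)) * R_dot I x J))"

lemma sum_code_weight:
  assumes "1 \<le> m" "m \<le> N" "1 \<le> I" "I < N" "s \<in> codes m"
  shows "(\<Sum>r | r \<in> codes N \<and> restrict r {1..m} = s. code_weight N I x r * tail_sign N m r)
    = dot_R I x (Delta_dot N I m (code_J I m s))"
proof -
  let ?F = "{r. r \<in> codes N \<and> restrict r {1..m} = s}"
  have "(\<Sum>r\<in>?F. code_weight N I x r * tail_sign N m r)
      = (\<Sum>r\<in>?F. \<Sum>J = 1..I + 1. (real (N choose (J - 1)) *
          (of_bool (\<forall>i\<in>{I + 1..N}. J \<le> r i) * tail_sign N m r)) * R_dot I x J)"
    unfolding code_weight_def sum_distrib_right by (intro sum.cong refl) simp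
  also have "\<dots> = (\<Sum>J = 1..I + 1. \<Sum>r\<in>?F. (real (N choose (J - 1)) *
          (of_bool (\<forall>i\<in>{I + 1..N}. J \<le> r i) * tail_sign N m r)) * R_dot I x J)"
    by (rule sum.swap)
  also have "\<dots> = (\<Sum>J = 1..I + 1. Delta_dot N I m (code_J I m s) J * R_dot I x J)"
    unfolding sum_distrib_right[symmetric] sum_distrib_left[symmetric]
    using assms by (intro sum.cong refl arg_cong2[where f = "(*)"] sum_tail_sign_extensions) auto
  finally show ?thesis by (simp add: dot_R_def)
qed

text \<open>Put \<open>h = J - 1\<close>. Since the J-statistic is at most \<open>I + 1\<close>,
  only \<open>h \<le> I\<close> occurs, and \<open>(1 - x) ^ (N - h)\<close> splits off the power
  \<open>(1 - x) ^ (N - I)\<close> that the normalisation cancels, leaving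
  \<open>R_dot\<close>.\<close>

lemma R_prob_eq_code_weight:
  assumes p: "p permutes {1..N}" and I: "I < N" and x: "x < 1"
  shows "R_prob N I x (J_stat N I p) = code_weight N I x (prefix_rank p) / fact N"
proof -
  let ?t = "\<lambda>h. real (N choose h) * x ^ h * (1 - x) ^ (N - h)"
  have "code_weight N I x (prefix_rank p)
      = (\<Sum>J = 1..I + 1. of_bool (J \<le> J_stat N I p) * (real (N choose (J - 1)) * R_dot I x J))"
    unfolding code_weight_def
    by (intro sum.cong refl) (use le_J_stat_iff[OF p I] I in auto)
  also have "\<dots> = (\<Sum>h = 0..<I + 1. of_bool (h < J_stat N I p) * (real (N choose h) * R_dot I x (Suc h)))"
    by (rule sum.reindex_bij_witness[of _ Suc "\<lambda>J. J - 1"]) auto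
  finally have cw: "code_weight N I x (prefix_rank p)
      = (\<Sum>h = 0..<I + 1. of_bool (h < J_stat N I p) * (real (N choose h) * R_dot I x (Suc h)))" .
  have "(1 - x) ^ (N - I) * code_weight N I x (prefix_rank p)
      = (\<Sum>h = 0..<I + 1. if h < J_stat N I p then ?t h else 0)"
    unfolding cw sum_distrib_left
  proof (intro sum.cong refl)
    fix h assume "h \<in> {0..<I + 1}"
    then have "N - h = (N - I) + (I - h)" using I by simp
    then show "(1 - x) ^ (N - I) * (of_bool (h < J_stat N I p) * (real (N choose h) * R_dot I x (Suc h)))
        = (if h < J_stat N I p then ?t h else 0)"
      by (simp add: R_dot_def power_add)
  qed
  also have "\<dots> = (\<Sum>h | h \<in> {0..<I + 1} \<and> h < J_stat N I p. ?t h)"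
    by (rule sum.inter_filter[symmetric]) simp
  also have "{h. h \<in> {0..<I + 1} \<and> h < J_stat N I p} = {0..<J_stat N I p}"
    using J_stat_le[OF p I] by auto
  finally show ?thesis
    using x by (simp add: R_prob_def field_simps)
qed

lemma later_records_restrict:
  assumes "1 \<le> m"
  shows "later_records N m (restrict r {1..N}) = later_records N m r"
  unfolding later_records_def by (rule arg_cong[of _ _ card]) (use assms in auto)

lemma code_weight_restrict: "code_weight N I x (restrict r {1..N}) = code_weight N I x r"
  unfolding code_weight_def by (intro sum.cong refl) auto

text \<open>The existential transfers \<open>record_stop\<close> from permutations to prefix codes;
  by \<open>record_stop_cong\<close> any other permutation with the same prefix gives the same
  answer.\<close>

definition stopped :: "nat \<Rightarrow> strategy \<Rightarrow> nat \<Rightarrow> (nat \<Rightarrow> nat) \<Rightarrow> bool" where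
  "stopped N A m s \<longleftrightarrow>
     (\<exists>p. p permutes {1..N} \<and> restrict (prefix_rank p) {1..m} = s \<and> record_stop N A m p)"

lemma stopped_iff_record_stop:
  assumes p: "p permutes {1..N}" and "1 \<le> N"
  shows "stopped N A m (restrict (prefix_rank p) {1..m}) \<longleftrightarrow> record_stop N A m p"
proof
  assume "stopped N A m (restrict (prefix_rank p) {1..m})"
  then obtain q where q: "q permutes {1..N}" "record_stop N A m q"
    and eq: "restrict (prefix_rank q) {1..m} = restrict (prefix_rank p) {1..m}"
    by (auto simp: stopped_def)
  have "prefix_rank q i = prefix_rank p i" if "i \<in> {1..m}" for i
    using fun_cong[OF eq, of i] that by simp
  then show "record_stop N A m p"
    using record_stop_cong[of q p N m A] permutes_inj[OF q(1)] permutes_inj[OF p] q(2) assms(2) by blast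
qed (use p in \<open>auto simp: stopped_def\<close>)

text \<open>Winning is replaced by its signed count of records. Since being stopped at
  \<open>m\<close> depends on the prefix alone, summing over the continuations of that prefix leaves
  the \<open>Delta_dot\<close> term.\<close>

lemma win_prob_eq_sum:
  assumes I: "1 \<le> I" "I < N" and x: "0 \<le> x" "x < 1"
  shows "win_prob N I x A =
    (\<Sum>m = 1..N. \<Sum>s | s \<in> codes m \<and> s m = m \<and> stopped N A m s.
       dot_R I x (Delta_dot N I m (code_J I m s))) / fact N"
proof -
  let ?P = "{p. p permutes {1..N}}"
  have finP: "finite ?P" by (rule finite_permutations) simp
  have set: "set_pmf (game_pmf N I x) \<subseteq> ?P"
    using pmf_game_pmf[OF I(2) x] by (auto simp: set_pmf_eq split: if_splits)
  have "win_prob N I x A = measure_pmf.prob (game_pmf N I x) {p \<in> ?P. wins N A p}"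
    unfolding win_prob_def using set by (intro measure_eq_AE) (auto simp: AE_measure_pmf_iff)
  also have "\<dots> = (\<Sum>p | p \<in> ?P \<and> wins N A p. pmf (game_pmf N I x) p)"
    using finP by (intro measure_measure_pmf_finite) simp
  also have "\<dots> = (\<Sum>p\<in>?P. if wins N A p then pmf (game_pmf N I x) p else 0)"
    using finP by (rule sum.inter_filter)
  also have "\<dots> = (\<Sum>p\<in>?P. of_bool (wins N A p) * pmf (game_pmf N I x) p)"
    by (intro sum.cong refl) simp
  also have "\<dots> = (\<Sum>p\<in>?P. of_bool (wins N A p) * code_weight N I x (prefix_rank p)) / fact N"
    unfolding sum_divide_distrib
    by (intro sum.cong refl) (use R_prob_eq_code_weight I x pmf_game_pmf[OF I(2) x] in auto)
  also have "(\<Sum>p\<in>?P. of_bool (wins N A p) * code_weight N I x (prefix_rank p))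
      = (\<Sum>m = 1..N. \<Sum>s | s \<in> codes m \<and> s m = m \<and> stopped N A m s.
          dot_R I x (Delta_dot N I m (code_J I m s)))"
  proof -
    \<comment> \<open>Depends on the code only, so the sum can be carried from permutations to codes
      and then grouped by the first \<open>m\<close> ranks.\<close>
    define F where "F = (\<lambda>m r. of_bool (r m = m \<and> stopped N A m (restrict r {1..m}))
      * (code_weight N I x r * tail_sign N m r))"
    have "(\<Sum>p\<in>?P. of_bool (wins N A p) * code_weight N I x (prefix_rank p))
        = (\<Sum>p\<in>?P. \<Sum>m = 1..N. F m (restrict (prefix_rank p) {1..N}))"
    proof (intro sum.cong refl)
      fix p assume p: "p \<in> ?P"
      have "of_bool (wins N A p) * code_weight N I x (prefix_rank p)
        = (\<Sum>m = 1..N. of_bool (prefix_rank p m = m \<and> record_stop N A m p)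
            * (code_weight N I x (prefix_rank p) * tail_sign N m (prefix_rank p)))"
      proof -
        have "p permutes {1..N}" "1 \<le> N" using p I by simp_all
        then show ?thesis
          unfolding of_bool_wins[OF \<open>p permutes {1..N}\<close> \<open>1 \<le> N\<close>] sum_distrib_right
          by (intro sum.cong refl) (simp only: mult_ac)
      qed
      also have "\<dots> = (\<Sum>m = 1..N. F m (restrict (prefix_rank p) {1..N}))"
      proof (intro sum.cong refl)
        fix m assume m: "m \<in> {1..N}"
        have "restrict (restrict (prefix_rank p) {1..N}) {1..m} = restrict (prefix_rank p) {1..m}"
          using m by (auto simp: restrict_def fun_eq_iff)
        then show "of_bool (prefix_rank p m = m \<and> record_stop N A m p)
            * (code_weight N I x (prefix_rank p) * tail_sign N m (prefix_rank p))
          = F m (restrict (prefix_rank p) {1..N})"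
          using m p I stopped_iff_record_stop[of p N A m]
          by (simp add: F_def code_weight_restrict tail_sign_def later_records_restrict del: One_nat_def)
      qed
      finally show "of_bool (wins N A p) * code_weight N I x (prefix_rank p)
        = (\<Sum>m = 1..N. F m (restrict (prefix_rank p) {1..N}))" .
    qed
    also have "\<dots> = (\<Sum>r\<in>codes N. \<Sum>m = 1..N. F m r)"
      by (rule sum.reindex_bij_betw[OF bij_betw_rank_code])
    also have "\<dots> = (\<Sum>m = 1..N. \<Sum>r\<in>codes N. F m r)"
      by (rule sum.swap)
    also have "\<dots> = (\<Sum>m = 1..N. \<Sum>s | s \<in> codes m \<and> s m = m \<and> stopped N A m s.
          dot_R I x (Delta_dot N I m (code_J I m s)))"
    proof (rule sum.cong[OF refl])
      fix m assume m: "m \<in> {1..N}"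
      have img: "(\<lambda>r. restrict r {1..m}) ` codes N \<subseteq> codes m"
        using m codes_range by (fastforce simp: codes_def)
      have "(\<Sum>r\<in>codes N. F m r) = (\<Sum>s\<in>codes m. \<Sum>r | r \<in> codes N \<and> restrict r {1..m} = s. F m r)"
        using finite_codes finite_codes img by (rule sum.group[symmetric])
      also have "\<dots> = (\<Sum>s\<in>codes m. if s m = m \<and> stopped N A m s
          then dot_R I x (Delta_dot N I m (code_J I m s)) else 0)"
      proof (intro sum.cong refl)
        fix s assume s: "s \<in> codes m"
        have "(\<Sum>r | r \<in> codes N \<and> restrict r {1..m} = s. F m r)
          = (\<Sum>r | r \<in> codes N \<and> restrict r {1..m} = s.
              of_bool (s m = m \<and> stopped N A m s) * (code_weight N I x r * tail_sign N m r))"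
        proof (intro sum.cong refl)
          fix r assume "r \<in> {r. r \<in> codes N \<and> restrict r {1..m} = s}"
          then have r: "restrict r {1..m} = s" by simp
          have "s m = r m" unfolding r[symmetric] using m by simp
          then show "F m r = of_bool (s m = m \<and> stopped N A m s) * (code_weight N I x r * tail_sign N m r)"
            by (simp only: F_def r)
        qed
        also have "\<dots> = of_bool (s m = m \<and> stopped N A m s) * dot_R I x (Delta_dot N I m (code_J I m s))"
          unfolding sum_distrib_left[symmetric] using sum_code_weight[of m N I s x] m I s by simp
        finally show "(\<Sum>r | r \<in> codes N \<and> restrict r {1..m} = s. F m r) =
          (if s m = m \<and> stopped N A m s then dot_R I x (Delta_dot N I m (code_J I m s)) else 0)"
          by simp
      qed
      also have "\<dots> = (\<Sum>s | s \<in> codes m \<and> s m = m \<and> stopped N A m s.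
          dot_R I x (Delta_dot N I m (code_J I m s)))"
        using finite_codes by (rule sum.inter_filter[symmetric])
      finally show "(\<Sum>r\<in>codes N. F m r) = (\<Sum>s | s \<in> codes m \<and> s m = m \<and> stopped N A m s.
          dot_R I x (Delta_dot N I m (code_J I m s)))" .
    qed
    finally show ?thesis .
  qed
  finally show ?thesis .
qed

section \<open>Record prefixes counted by their J-statistic\<close>

lemma card_codes_J_ge:
  assumes "I + 1 < k" "1 \<le> j" "j \<le> k"
  shows "card {s \<in> codes k. s k = k \<and> j \<le> code_J I k s} = fact I * (\<Prod>i = I + 1..k - 1. i + 1 - j)"
proof -
  \<comment> \<open>The admissible ranks: unrestricted up to \<open>I\<close>, at least
    \<open>j\<close> beyond it, and the top rank in position \<open>k\<close>, which makes
    \<open>k\<close> a record.\<close>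
  define B where "B = (\<lambda>i. if i \<le> I then {1..i} else if i < k then {j..i} else {k})"
  have "s \<in> codes k \<and> s k = k \<and> j \<le> code_J I k s \<longleftrightarrow> s \<in> (\<Pi>\<^sub>E i\<in>{1..k}. B i)" for s
  proof
    assume s: "s \<in> codes k \<and> s k = k \<and> j \<le> code_J I k s"
    then have "\<forall>i\<in>{I + 1..k}. j \<le> s i" using le_code_J_iff[of k I j s] by blast
    then have "s i \<in> B i" if "i \<in> {1..k}" for i
      using codes_range[of s k i] that s by (auto simp: B_def)
    then show "s \<in> (\<Pi>\<^sub>E i\<in>{1..k}. B i)" using s by (auto simp: codes_def PiE_iff)
  next
    assume s: "s \<in> (\<Pi>\<^sub>E i\<in>{1..k}. B i)"
    have k: "s k = k" using PiE_mem[OF s, of k] assms by (simp add: B_def)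
    have "s i \<in> {1..i}" if "i \<in> {1..k}" for i
      using PiE_mem[OF s that] that assms by (auto simp: B_def split: if_splits)
    moreover have "j \<le> s i" if "i \<in> {I + 1..k}" for i
      using PiE_mem[OF s, of i] that assms by (auto simp: B_def split: if_splits)
    ultimately show "s \<in> codes k \<and> s k = k \<and> j \<le> code_J I k s"
      using s k le_code_J_iff[of k I j s] assms by (auto simp: codes_def PiE_iff)
  qed
  then have "{s \<in> codes k. s k = k \<and> j \<le> code_J I k s} = (\<Pi>\<^sub>E i\<in>{1..k}. B i)" by blast
  also have "card \<dots> = (\<Prod>i\<in>{1..k}. card (B i))" by (simp add: card_PiE)
  also have "{1..k} = {1..I} \<union> {I + 1..k - 1} \<union> {k}" using assms by auto
  also have "(\<Prod>i\<in>\<dots>. card (B i)) = (\<Prod>i\<in>{1..I} \<union> {I + 1..k - 1}. card (B i)) * (\<Prod>i\<in>{k}. card (B i))"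
    using assms by (intro prod.union_disjoint) auto
  also have "(\<Prod>i\<in>{1..I} \<union> {I + 1..k - 1}. card (B i))
      = (\<Prod>i = 1..I. card (B i)) * (\<Prod>i = I + 1..k - 1. card (B i))"
    by (intro prod.union_disjoint) auto
  also have "(\<Prod>i = 1..I. card (B i)) = fact I"
    unfolding fact_prod by (auto simp: B_def intro!: prod.cong)
  also have "(\<Prod>i = I + 1..k - 1. card (B i)) = (\<Prod>i = I + 1..k - 1. i + 1 - j)"
    using assms by (intro prod.cong) (auto simp: B_def)
  also have "(\<Prod>i\<in>{k}. card (B i)) = 1" using assms by (simp add: B_def)
  finally show ?thesis by simp
qed

text \<open>For \<open>k = I + 1\<close> the J-statistic is the rank of the record itself, hence
  \<open>k\<close>. For larger \<open>k\<close> the count is the difference of the counts for at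
  least \<open>j\<close> and at least \<open>j + 1\<close>, and its factor \<open>k - I - 1\<close>
  is \<open>(k - j) - (I + 1 - j)\<close>.\<close>

lemma card_codes_J_eq:
  assumes "I < k" "1 \<le> j" "j \<le> I + 1"
  shows "real (card {s \<in> codes k. s k = k \<and> code_J I k s = j}) = mu I k j"
proof (cases "k = I + 1")
  case True
  have J: "code_J I k s = s k" for s unfolding code_J_def True by simp
  show ?thesis
  proof (cases "j = k")
    case True
    have "{s \<in> codes k. s k = k} = (\<Pi>\<^sub>E i\<in>{1..k}. if i = k then {k} else {1..i})"
    proof -
      have "s \<in> codes k \<and> s k = k \<longleftrightarrow> s \<in> (\<Pi>\<^sub>E i\<in>{1..k}. if i = k then {k} else {1..i})" for s
      proof
        assume "s \<in> codes k \<and> s k = k"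
        then show "s \<in> (\<Pi>\<^sub>E i\<in>{1..k}. if i = k then {k} else {1..i})"
          by (simp add: codes_def PiE_iff)
      next
        assume s: "s \<in> (\<Pi>\<^sub>E i\<in>{1..k}. if i = k then {k} else {1..i})"
        have "s k = k" using PiE_mem[OF s, of k] assms by simp
        moreover have "s i \<in> {1..i}" if "i \<in> {1..k}" for i
          using PiE_mem[OF s that] that by (simp split: if_splits)
        ultimately show "s \<in> codes k \<and> s k = k"
          using s by (simp add: codes_def PiE_iff)
      qed
      then show ?thesis by blast
    qed
    then have "card {s \<in> codes k. s k = k} = (\<Prod>i = 1..k. card (if i = k then {k} else {1..i}))"
      by (simp only: card_PiE finite_atLeastAtMost)
    also have "\<dots> = (\<Prod>i\<in>{1..k} - {k}. i)"
      using assms by (subst prod.remove[of _ k]) (auto intro!: prod.cong)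
    also have "{1..k} - {k} = {1..k - 1}" using assms by auto
    finally have "card {s \<in> codes k. s k = k} = fact (k - 1)" by (simp add: fact_prod)
    moreover have "{s \<in> codes k. s k = k \<and> code_J I k s = j} = {s \<in> codes k. s k = k}"
      using J True by auto
    ultimately show ?thesis using True \<open>k = I + 1\<close> by (simp add: mu_def)
  next
    case False
    then have "{s \<in> codes k. s k = k \<and> code_J I k s = j} = {}" using J by auto
    then show ?thesis using False \<open>k = I + 1\<close> assms by (simp only:) (simp add: mu_def)
  qed
next
  case False
  then have k: "I + 1 < k" using assms by simp
  let ?G = "\<lambda>j. {s \<in> codes k. s k = k \<and> j \<le> code_J I k s}"
  have "{s \<in> codes k. s k = k \<and> code_J I k s = j} = ?G j - ?G (j + 1)" by auto
  moreover have "card (?G j - ?G (j + 1)) = card (?G j) - card (?G (j + 1))"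
    using finite_codes by (intro card_Diff_subset) auto
  moreover have "card (?G (j + 1)) \<le> card (?G j)"
    using finite_codes by (intro card_mono) auto
  ultimately have "real (card {s \<in> codes k. s k = k \<and> code_J I k s = j})
      = real (card (?G j)) - real (card (?G (j + 1)))" by simp
  also have "real (card (?G j)) = fact I * (\<Prod>i = I + 1..k - 1. real (i - (j - 1)))"
    using card_codes_J_ge[OF k, of j] assms by (simp add: Suc_diff_le)
  also have "(\<Prod>i = I + 1..k - 1. real (i - (j - 1))) = fact (k - j) / fact (I + 1 - j)"
    using prod_diff_fact[of "j - 1" I "k - 1"] assms k by simp
  also have "real (card (?G (j + 1))) = fact I * (\<Prod>i = I + 1..k - 1. real (i - j))"
    using card_codes_J_ge[OF k, of "j + 1"] assms k by simp
  \<comment> \<open>Expanded to the denominator \<open>fact (I + 1 - j)\<close> of the other count.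
    At \<open>j = I + 1\<close> both sides vanish through the factor at
    \<open>i = I + 1\<close>.\<close>
  also have "(\<Prod>i = I + 1..k - 1. real (i - j)) = real (I + 1 - j) * fact (k - j - 1) / fact (I + 1 - j)"
  proof (cases "j = I + 1")
    case True
    then have "(\<Prod>i = I + 1..k - 1. real (i - j)) = 0"
      using k by (auto intro!: bexI[of _ "I + 1"])
    then show ?thesis using True by simp
  next
    case False
    then have "j \<le> I" using assms by simp
    then show ?thesis
      using prod_diff_fact[of j I "k - 1"] assms k by (simp add: Suc_diff_le fact_reduce)
  qed
  also have "fact (k - j) = real (k - j) * fact (k - j - 1)"
    using assms k by (intro fact_reduce) simp
  also have "fact I * (real (k - j) * fact (k - j - 1) / fact (I + 1 - j))
      - fact I * (real (I + 1 - j) * fact (k - j - 1) / fact (I + 1 - j))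
      = (real (k - j) - real (I + 1 - j)) * fact I * fact (k - j - 1) / fact (I + 1 - j)"
    by (simp add: algebra_simps diff_divide_distrib)
  also have "real (k - j) - real (I + 1 - j) = real (k - I - 1)" using assms k by simp
  finally show ?thesis using k by (simp add: mu_def)
qed

lemma sum_codes_by_J:
  fixes f :: "nat \<Rightarrow> real"
  assumes "I < k"
  shows "(\<Sum>s | s \<in> codes k \<and> s k = k. f (code_J I k s)) = (\<Sum>j = 1..I + 1. mu I k j * f j)"
proof -
  let ?C = "{s. s \<in> codes k \<and> s k = k}"
  have fin: "finite ?C" using finite_codes by simp
  have "(\<Sum>s\<in>?C. f (code_J I k s)) = (\<Sum>j = 1..I + 1. \<Sum>s | s \<in> ?C \<and> code_J I k s = j. f (code_J I k s))"
  proof (rule sum.group[symmetric, OF fin])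
    show "code_J I k ` ?C \<subseteq> {1..I + 1}"
      using code_J_range codes_range by blast
  qed simp
  also have "\<dots> = (\<Sum>j = 1..I + 1. mu I k j * f j)"
  proof (intro sum.cong refl)
    fix j assume j: "j \<in> {1..I + 1}"
    have "(\<Sum>s | s \<in> ?C \<and> code_J I k s = j. f (code_J I k s))
        = (\<Sum>s | s \<in> ?C \<and> code_J I k s = j. f j)" by (intro sum.cong) auto
    also have "\<dots> = real (card {s \<in> codes k. s k = k \<and> code_J I k s = j}) * f j"
      by (simp add: conj_assoc)
    also have "\<dots> = mu I k j * f j" using card_codes_J_eq[OF assms, of j] j by simp
    finally show "(\<Sum>s | s \<in> ?C \<and> code_J I k s = j. f (code_J I k s)) = mu I k j * f j" .
  qed
  finally show ?thesis .
qed

subsection \<open>The optimal strategy\<close>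

text \<open>A strategy sees only a flattening, so a permutation producing it is quantified; the
  conditions depend on its first \<open>k\<close> ranks alone. Nothing is accepted up to
  \<open>I\<close>, where every value is negative.\<close>

definition positive_strategy :: "nat \<Rightarrow> nat \<Rightarrow> real \<Rightarrow> strategy" where
  "positive_strategy N I x k \<sigma> \<longleftrightarrow>
     (\<exists>p. p permutes {1..N} \<and> prefix_flattening k p = \<sigma> \<and> prefix_rank p k = k \<and>
       I < k \<and> 0 \<le> dot_R I x (Delta_dot N I k (code_J I k (prefix_rank p))))"

lemma positive_strategy_iff:
  assumes p: "p permutes {1..N}"
  shows "positive_strategy N I x k (prefix_flattening k p) \<longleftrightarrow>
    prefix_rank p k = k \<and> I < k \<and> 0 \<le> dot_R I x (Delta_dot N I k (code_J I k (prefix_rank p)))"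
proof
  assume "positive_strategy N I x k (prefix_flattening k p)"
  then obtain q where q: "q permutes {1..N}" "prefix_flattening k q = prefix_flattening k p"
    "prefix_rank q k = k" "I < k" "0 \<le> dot_R I x (Delta_dot N I k (code_J I k (prefix_rank q)))"
    unfolding positive_strategy_def by blast
  have eq: "\<And>i. i \<in> {1..k} \<Longrightarrow> prefix_rank q i = prefix_rank p i"
    using q(2) prefix_flattening_eq_iff[OF permutes_inj[OF q(1)] permutes_inj[OF p]] by blast
  then have "code_J I k (prefix_rank q) = code_J I k (prefix_rank p)" by (rule code_J_cong)
  then show "prefix_rank p k = k \<and> I < k \<and> 0 \<le> dot_R I x (Delta_dot N I k (code_J I k (prefix_rank p)))"
    using q eq[of k] by simp
qed (use p in \<open>auto simp: positive_strategy_def\<close>)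

lemma code_extends:
  assumes "s \<in> codes m" "m \<le> N"
  obtains p where "p permutes {1..N}" "restrict (prefix_rank p) {1..m} = s"
proof -
  \<comment> \<open>Rank 1 is admissible in every position, so it serves as padding.\<close>
  define r where "r = (\<lambda>i\<in>{1..N}. if i \<le> m then s i else 1)"
  have "r i \<in> {1..i}" if "i \<in> {1..N}" for i
    using codes_range[OF assms(1), of i] that by (simp add: r_def)
  then have "r \<in> codes N" by (simp add: codes_def PiE_iff r_def)
  then obtain p where p: "p permutes {1..N}" "r = restrict (prefix_rank p) {1..N}"
    using bij_betw_rank_code[of N] unfolding bij_betw_def by blast
  have "restrict (prefix_rank p) {1..m} i = s i" for i
  proof (cases "i \<in> {1..m}")
    case True
    then have "r i = s i" "r i = prefix_rank p i"
      using assms(2) by (simp add: r_def, simp add: p(2))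
    then show ?thesis using True by simp
  next
    case False
    then have "s i = undefined"
      using assms(1) unfolding codes_def by (rule PiE_arb[rotated])
    then show ?thesis using False by auto
  qed
  with p(1) that show ?thesis by (metis ext)
qed

text \<open>At size \<open>N\<close> the harmonic sums are empty and each advantage is 1. Thus a
  forced stop at the end satisfies the positivity criterion.\<close>

lemma Delta_dot_top_nonneg:
  assumes "I < N" "0 \<le> x" "x < 1" "j \<le> I + 1"
  shows "0 \<le> dot_R I x (Delta_dot N I N j)"
  unfolding dot_R_Delta_dot[OF assms(1,4)]
  by (intro sum_nonneg mult_nonneg_nonneg stop_weight_nonneg)
     (use assms in \<open>auto simp: advantage_def\<close>)

text \<open>A record that is itself positive has been accepted unless an earlier one was.
  Conversely, a stop by time \<open>m\<close> happened at a positive record, and persistence carries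
  positivity on to \<open>m\<close>.\<close>

lemma stopped_positive_strategy_iff:
  assumes I: "I < N" and x: "0 \<le> x" "x < 1" and sq: "I + 1 \<le> (N - I)\<^sup>2"
    and m: "m \<in> {1..N}" and s: "s \<in> codes m" "s m = m"
  shows "stopped N (positive_strategy N I x) m s \<longleftrightarrow>
    I < m \<and> 0 \<le> dot_R I x (Delta_dot N I m (code_J I m s))"
proof -
  have N: "1 \<le> N" using I by simp
  obtain p where p: "p permutes {1..N}" and ps: "restrict (prefix_rank p) {1..m} = s"
    using code_extends[OF s(1), of N] m by auto
  have rank: "prefix_rank p i = s i" if "i \<in> {1..m}" for i
    using fun_cong[OF ps, of i] that by simp
  let ?A = "positive_strategy N I x"
  let ?T = "stop_position N ?A p"
  let ?D = "\<lambda>k. dot_R I x (Delta_dot N I k (code_J I k (prefix_rank p)))"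
  have T: "?T \<in> {1..N}" using stop_position(1)[OF N] .
  have J: "code_J I m s = code_J I m (prefix_rank p)"
    using rank by (intro code_J_cong) simp
  have Jr: "code_J I k (prefix_rank p) \<in> {1..I + 1}" for k
    by (intro code_J_range prefix_rank_in_range) simp
  have "stopped N ?A m s \<longleftrightarrow> record_stop N ?A m p"
    using stopped_iff_record_stop[OF p N, of ?A m] by (simp only: ps)
  also have "\<dots> \<longleftrightarrow> I < m \<and> 0 \<le> ?D m"
  proof
    assume stop: "record_stop N ?A m p"
    then have Tm: "?T \<le> m" by (simp add: record_stop_def)
    have "I < ?T \<and> 0 \<le> ?D ?T"
    proof (cases "?A ?T (prefix_flattening ?T p)")
      case True
      then show ?thesis using positive_strategy_iff[OF p] by blast
    next
      case False
      then have "?T = N" using stop_position(2)[OF N, of ?A p] by blast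
      then show ?thesis using Delta_dot_top_nonneg[of I N x] Jr[of N] I x by simp
    qed
    \<comment> \<open>The minimum of ranks runs over more positions at \<open>m\<close>, so
      persistence is needed in both arguments.\<close>
    moreover have "code_J I m (prefix_rank p) \<le> code_J I ?T (prefix_rank p)"
      using calculation Tm by (intro code_J_mono) auto
    ultimately show "I < m \<and> 0 \<le> ?D m"
      using Delta_dot_nonneg_mono[of I ?T m N x] Jr[of m] Jr[of ?T] Tm m x sq by auto
  next
    assume "I < m \<and> 0 \<le> ?D m"
    then have "?A m (prefix_flattening m p)"
      using positive_strategy_iff[OF p] rank[of m] s(2) m by simp
    then have Tm: "?T \<le> m" using stop_position(3)[OF N, of m ?A p] m by simp
    have "prefix_rank p ?T = ?T"
    proof (cases "?A ?T (prefix_flattening ?T p)")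
      case True
      then show ?thesis using positive_strategy_iff[OF p] by blast
    next
      case False
      \<comment> \<open>A forced stop together with \<open>?T \<le> m\<close> gives
        \<open>m = N\<close>, which is a record by assumption.\<close>
      then have "?T = N" using stop_position(2)[OF N, of ?A p] by blast
      then show ?thesis using Tm m rank[of m] s(2) by simp
    qed
    then show "record_stop N ?A m p" using Tm by (simp add: record_stop_def)
  qed
  finally show ?thesis by (simp only: J)
qed

theorem theorem6p6:
  fixes N I :: nat and x :: real
  assumes "1 \<le> I" and "I < N"
    and "0 \<le> x" and "x < 1"
    and "real I \<le> real N - sqrt (real N + 5 / 4) + 1 / 2"
    and "\<forall>k\<in>{1..I}. dot_R I x (Delta_dot_low N I k) < 0"
  shows "optimal_win_prob N I x =
           (\<Sum>(k, j) | k \<in> {1..N} \<and> j \<in> {1..I + 1} \<and> dot_R I x (Delta_dot N I k j) \<ge> 0.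
              mu I k j / fact N * dot_R I x (Delta_dot N I k j)) \<and>
         optimal_win_prob N I x =
           (\<Sum>k = 1..N. \<Sum>j = 1..I + 1.
              mu I k j / fact N * max 0 (dot_R I x (Delta_dot N I k j)))"
proof -
  define D where "D = (\<lambda>k j. dot_R I x (Delta_dot N I k j))"
  define V where "V = (\<Sum>k = 1..N. \<Sum>j = 1..I + 1. mu I k j / fact N * max 0 (D k j))"
  define U where "U = (\<lambda>m. \<Sum>s | s \<in> codes m \<and> s m = m. max 0 (D m (code_J I m s)))"
  have sq: "I + 1 \<le> (N - I)\<^sup>2" using square_bound assms by blast
  have low: "D k j < 0" if "k \<in> {1..I}" for k j
    using assms(6) that by (simp add: D_def Delta_dot_eq_low)
  have U: "U m = (\<Sum>j = 1..I + 1. mu I m j * max 0 (D m j))" if "m \<in> {1..N}" for m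
  proof (cases "I < m")
    case True
    then show ?thesis unfolding U_def by (rule sum_codes_by_J)
  next
    case False
    \<comment> \<open>For \<open>m \<le> I\<close>, \<open>mu I m j\<close> is
      \<open>fact (m - 1)\<close> for every \<open>j\<close>, so the sum over \<open>j\<close>
      counts each prefix \<open>I + 1\<close> times; equality holds because all positive parts
      vanish.\<close>
    then have "max 0 (D m j) = 0" for j using low[of m j] that by simp
    then show ?thesis by (simp add: U_def)
  qed
  have V: "V = (\<Sum>m = 1..N. U m) / fact N"
    unfolding V_def sum_divide_distrib
  proof (rule sum.cong[OF refl])
    fix m assume "m \<in> {1..N}"
    then show "(\<Sum>j = 1..I + 1. mu I m j / fact N * max 0 (D m j)) = U m / fact N"
      unfolding U[OF \<open>m \<in> {1..N}\<close>] sum_divide_distrib by (intro sum.cong refl) simp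
  qed
  have win: "win_prob N I x A =
      (\<Sum>m = 1..N. \<Sum>s | s \<in> codes m \<and> s m = m \<and> stopped N A m s. D m (code_J I m s)) / fact N" for A
    unfolding D_def using assms by (intro win_prob_eq_sum)
  have stop_sum: "(\<Sum>s | s \<in> codes m \<and> s m = m \<and> stopped N A m s. D m (code_J I m s))
      = (\<Sum>s | s \<in> codes m \<and> s m = m. if stopped N A m s then D m (code_J I m s) else 0)" for A m
  proof -
    have "finite {s. s \<in> codes m \<and> s m = m}" using finite_codes by simp
    from sum.inter_filter[OF this, of "\<lambda>s. D m (code_J I m s)" "stopped N A m"]
    show ?thesis by (simp add: conj_assoc)
  qed
  \<comment> \<open>Each prefix contributes either its value or 0, both at most the positive
    part.\<close>
  have upper: "win_prob N I x A \<le> V" for A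
    unfolding win V stop_sum U_def by (intro divide_right_mono sum_mono) auto
  have attained: "win_prob N I x (positive_strategy N I x) = V"
    unfolding win V stop_sum U_def
  proof (intro arg_cong[of _ _ "\<lambda>t. t / fact N"] sum.cong refl)
    fix m s assume ms: "m \<in> {1..N}" "s \<in> {s. s \<in> codes m \<and> s m = m}"
    have "stopped N (positive_strategy N I x) m s \<longleftrightarrow> I < m \<and> 0 \<le> D m (code_J I m s)"
      unfolding D_def using stopped_positive_strategy_iff assms sq ms by blast
    moreover have "D m (code_J I m s) < 0" if "m \<le> I" using low ms that by simp
    ultimately show "(if stopped N (positive_strategy N I x) m s then D m (code_J I m s) else 0)
        = max 0 (D m (code_J I m s))" by (cases "I < m") auto
  qed
  have opt: "optimal_win_prob N I x = V"
    unfolding optimal_win_prob_def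
  proof (rule Max_eqI)
    show "finite (range (win_prob N I x))" using finite_range_win_prob assms by blast
    show "V \<in> range (win_prob N I x)" using attained by (metis rangeI)
  qed (use upper in auto)
  have "V = (\<Sum>(k, j)\<in>{1..N} \<times> {1..I + 1}. mu I k j / fact N * max 0 (D k j))"
    unfolding V_def by (rule sum.cartesian_product)
  \<comment> \<open>Pairs with a negative value have positive part 0 and drop out of the
    sum.\<close>
  also have "\<dots> = (\<Sum>(k, j) | k \<in> {1..N} \<and> j \<in> {1..I + 1} \<and> D k j \<ge> 0. mu I k j / fact N * D k j)"
    by (rule sum.mono_neutral_cong_right) (auto simp: max_def split: if_splits)
  finally show ?thesis
    using opt unfolding V_def D_def by simp
qed

end
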